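(* Let $v:\mathbb{R}\to\mathbb{R}$ be a smooth $1$-periodic function with $\max_{\mathbb{R}}v=0$, let $\mathcal{M}_0=\{x\in[0,1): v(x)=0\}$, and assume that $\mathcal{M}_0$ is finite and that the values $v''(x)$, $x\in\mathcal{M}_0$, are pairwise distinct. Let $\mu\in\mathbb{R}$ satisfy $$|\mu|<\int_0^1\sqrt{(1-v(y))^2-1}\,dy .$$ Let $\bar x\in\mathcal{M}_0$ be the unique point with $-v''(\bar x)=\min_{x\in\mathcal{M}_0}\{-v''(x)\}$, and let $x_\mu\in(\bar x,\bar x+1)$ be the unique point such that $$\int_{\bar x}^{x_\mu}\sqrt{(1-v(y))^2-1}\,dy-\int_{x_\mu}^{\bar x+1}\sqrt{(1-v(y))^2-1}\,dy=\mu .$$ For $d>0$ let $w$ (depending on $d$) be the unique $C^2$ $1$-periodic solution with $w(0)=0$ of $$-\frac{d\,w''}{1+(\mu+w')^2}+\sqrt{1+(\mu+w')^2}+v(y)=\overline H_d(\mu)\quad\text{in }\mathbb{R},$$ where $\overline H_d(\mu)$ is the unique real number for which this ODE has a $C^2$ $1$-periodic solution. Then $$\lim_{d\to0^+}w(x)=w_0(x)-w_0(0)\quad\text{uniformly in }x\in\mathbb{R},$$ where $w_0$ is the $1$-periodic function on $\mathbb{R}$ given on $[\bar x,\bar x+1]$ by $$w_0(x)=\begin{cases}\displaystyle\int_{\bar x}^{x}\sqrt{(1-v(y))^2-1}\,dy-\mu x, & x\in[\bar x,x_\mu],\\[2mm] \displaystyle\int_{\bar x}^{x_\mu}\sqrt{(1-v(y))^2-1}\,dy-\int_{x_\mu}^{x}\sqrt{(1-v(y))^2-1}\,dy-\mu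 x, & x\in[x_\mu,\bar x+1].\end{cases}$$
   Context: For each $d>0$ and $\mu\in\mathbb{R}$ the number $\overline H_d(\mu)$ exists and is unique, and the normalized solution $w$ with $w(0)=0$ is unique. *)

theory Defs
  imports "HOL-Analysis.Analysis"
begin

definition smooth :: "(real \<Rightarrow> real) \<Rightarrow> bool" where
  "smooth f \<longleftrightarrow> (\<forall>n x. (deriv ^^ n) f differentiable (at x))"

definition C2 :: "(real \<Rightarrow> real) \<Rightarrow> bool" where
  "C2 f \<longleftrightarrow> (\<forall>x. f differentiable (at x)) \<and> (\<forall>x. deriv f differentiable (at x))
     \<and> continuous_on UNIV (deriv (deriv f))"

definition one_periodic :: "(real \<Rightarrow> real) \<Rightarrow> bool" where
  "one_periodic f \<longleftrightarrow> (\<forall>x. f (x + 1) = f x)"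

definition zero_points :: "(real \<Rightarrow> real) \<Rightarrow> real set" where
  "zero_points v = {x \<in> {0..<1}. v x = 0}"

text \<open>The nonnegative root \<open>p\<close> of the inviscid equation \<open>sqrt (1 + p\<^sup>2) + v y = 1\<close>.\<close>

definition slope :: "(real \<Rightarrow> real) \<Rightarrow> real \<Rightarrow> real" where
  "slope v y = sqrt ((1 - v y)\<^sup>2 - 1)"

definition cell_solution ::
  "(real \<Rightarrow> real) \<Rightarrow> real \<Rightarrow> real \<Rightarrow> real \<Rightarrow> (real \<Rightarrow> real) \<Rightarrow> bool" where
  "cell_solution v d \<mu> H w \<longleftrightarrow> C2 w \<and> one_periodic w \<and>
     (\<forall>y. - (d * deriv (deriv w) y) / (1 + (\<mu> + deriv w y)\<^sup>2)
          + sqrt (1 + (\<mu> + deriv w y)\<^sup>2) + v y = H)"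

definition effective_H :: "(real \<Rightarrow> real) \<Rightarrow> real \<Rightarrow> real \<Rightarrow> real" where
  "effective_H v d \<mu> = (THE H. \<exists>w. cell_solution v d \<mu> H w)"

end

theory Submission
  imports Defs "HOL-Library.Periodic_Fun" "HOL-Computational_Algebra.Polynomial"
begin

text \<open>
  Write \<open>p = \<mu> + w'\<close> for the tilted slope, \<open>F p = sqrt (1 + p\<^sup>2)\<close> and \<open>s\<close> for the inviscid
  slope, so that \<open>F s = 1 - v\<close>. The equation becomes the first-order periodic equation
  \<open>d p' = (1 + p\<^sup>2) (F p + v - H)\<close> with mean \<open>\<mu>\<close>, and every a priori bound comes from one
  principle: a function \<open>B\<close> with \<open>d B' < (1 + B\<^sup>2) (F B + v - H)\<close> can be crossed by \<open>p\<close> only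
  upwards, and only downwards under the reverse inequality. A solution that is trapped beyond
  \<open>s\<close> or \<open>-s\<close> over a whole period has a mean of modulus at least \<open>\<integral> s\<close>, which the bound on \<open>\<mu>\<close>
  excludes.

  Three bounds follow. The barriers \<open>\<plusminus> sqrt (s\<^sup>2 + \<eta>)\<close> give \<open>H < 1 + \<eta>\<close> and then
  \<open>p\<^sup>2 \<le> s\<^sup>2 + \<eta>\<close> for small \<open>d\<close> (\<open>energy_upper_bound\<close>, \<open>slope_confinement\<close>). A cubic barrier
  through a zero \<open>c\<close> of \<open>v\<close> gives \<open>1 - H \<le> d b\<close> as soon as \<open>b\<^sup>2 > - v'' c\<close>
  (\<open>energy_lower_bound\<close>); it is best at the flattest zero \<open>xbar\<close>. Conversely, to cross from
  negative to positive values through a zero \<open>z\<close> of \<open>v\<close>, a solution must beat a line of any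
  slope \<open>b < sqrt (- v'' z)\<close>, which forces \<open>1 - H > d b\<close> for small \<open>d\<close>. The other zeros are strictly sharper
  than \<open>xbar\<close>, so a common \<open>b\<close> between the two bounds yields a barrier on the whole period away
  from \<open>xbar\<close> that is crossed only downwards (\<open>falling_barrier\<close>). Hence in one period starting
  at \<open>xbar\<close> the slope stays off \<open>-s\<close> before some point \<open>t\<close> and off \<open>s\<close> after it
  (\<open>single_sign_change\<close>).

  Finally the equation is an exact identity for \<open>F s - F p\<close>: it equals
  \<open>1 - H - d (arctan p)'\<close>, so its integral over a period is \<open>1 - H\<close>, which tends to zero.
  Together with the sign information this makes \<open>p\<close> close in mean to \<open>s\<close> before \<open>t\<close> and to
  \<open>-s\<close> after \<open>t\<close> (\<open>solution_close_to_tent\<close>). The mean \<open>\<mu>\<close> then forces the tent with top \<open>t\<close>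
  to agree with the one with top \<open>x\<mu>\<close>.
\<close>

section \<open>Crossing arguments and other real analysis\<close>

lemma upcrossing_stays_positive:
  fixes f f' :: "real \<Rightarrow> real"
  assumes "a < b" and der: "\<And>x. x \<in> {a..b} \<Longrightarrow> (f has_real_derivative f' x) (at x)"
    and up: "\<And>x. x \<in> {a..b} \<Longrightarrow> f x = 0 \<Longrightarrow> f' x > 0"
    and "f a \<ge> 0"
  shows "f b > 0"
proof (rule ccontr)
  assume neg: "\<not> f b > 0"
  have cont: "continuous_on {a..b} f"
    using der by (meson DERIV_isCont continuous_at_imp_continuous_on)
  define Z where "Z = {x \<in> {a..b}. f x \<ge> 0 \<and> x < b}"
  have "a \<in> Z" using assms by (auto simp: Z_def)
  have bdd: "bdd_above Z" by (rule bdd_aboveI[of _ b]) (auto simp: Z_def)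
  define z where "z = Sup Z"
  have za: "a \<le> z" "z \<le> b"
    using \<open>a \<in> Z\<close> bdd unfolding z_def
    by (auto intro!: cSup_upper cSup_least simp: Z_def)
  have "closed {x \<in> {a..b}. f x \<ge> 0}"
    using continuous_closed_preimage[OF cont, of "{0..}"] by (simp add: vimage_def Int_def)
  moreover have "z \<in> closure Z"
    unfolding z_def using \<open>a \<in> Z\<close> bdd closure_contains_Sup by blast
  moreover have "closure Z \<subseteq> closure {x \<in> {a..b}. f x \<ge> 0}"
    by (rule closure_mono) (auto simp: Z_def)
  ultimately have fz: "f z \<ge> 0" by auto
  have after: "f x < 0" if "z < x" "x < b" for x
  proof (rule ccontr)
    assume "\<not> f x < 0"
    then have "x \<in> Z" using that za by (auto simp: Z_def)
    then show False using cSup_upper[OF _ bdd] that by (force simp: z_def)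
  qed
  have "f z = 0"
  proof (cases "z = b")
    case True with fz neg show ?thesis by auto
  next
    case False
    then have "z < b" using za by auto
    have "isCont f z" using der za by (auto intro: DERIV_isCont)
    then have "(f \<longlongrightarrow> f z) (at_right z)"
      by (simp add: isCont_def filterlim_at_split)
    moreover have "eventually (\<lambda>x. f x \<le> 0) (at_right z)"
      using after \<open>z < b\<close> by (auto simp: eventually_at_right_field intro: less_imp_le)
    ultimately have "f z \<le> 0"
      by (intro tendsto_upperbound[of f _ "at_right z"]) auto
    with fz show ?thesis by auto
  qed
  then have pos: "f' z > 0" using up za by auto
  note dz = der[of z]
  show False
  proof (cases "z = b")
    case False
    then have "z < b" using za by auto
    obtain e where e: "e > 0" "\<And>h. h > 0 \<Longrightarrow> h < e \<Longrightarrow> f z < f (z + h)"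
      using DERIV_pos_inc_right[OF dz pos] za by auto
    define h where "h = min (e/2) ((b - z)/2)"
    have "h > 0" "h < e" "z + h < b" using e \<open>z < b\<close> by (auto simp: h_def min_def field_simps)
    then show False using e(2)[of h] after[of "z+h"] \<open>f z = 0\<close> by auto
  next
    case True
    \<comment> \<open>left of the endpoint \<open>f\<close> is negative, so points of \<open>Z\<close> cannot accumulate at \<open>b\<close>\<close>
    obtain e where e: "e > 0" "\<And>h. h > 0 \<Longrightarrow> h < e \<Longrightarrow> f (z - h) < f z"
      using DERIV_pos_inc_left[OF dz pos] za by auto
    obtain x where x: "x \<in> Z" "z - e < x"
      using less_cSup_iff[of Z "z - e"] \<open>a \<in> Z\<close> bdd e(1) by (auto simp: z_def)
    then have "x < z" using True by (auto simp: Z_def)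
    then have "f x < f z" using e(2)[of "z - x"] x by auto
    then show False using x \<open>f z = 0\<close> by (auto simp: Z_def)
  qed
qed

lemma isCont_eventually_pos:
  fixes f :: "real \<Rightarrow> real"
  assumes "isCont f x" "f x > 0"
  shows "\<forall>\<^sub>F y in nhds x. f y > 0"
  using assms order_tendstoD(1)[of f "f x" "nhds x" 0]
  by (simp add: isCont_def tendsto_at_iff_tendsto_nhds)

text \<open>
  The form in which compactness is used for all barriers: a parameter that may depend on the
  point can be chosen uniformly.
\<close>
lemma compact_local_threshold:
  fixes P :: "real \<Rightarrow> 'a::topological_space \<Rightarrow> bool"
  assumes "compact J"
    and mono: "\<And>N N' x. N \<le> N' \<Longrightarrow> P N x \<Longrightarrow> P N' x"
    and loc: "\<And>x. x \<in> J \<Longrightarrow> \<exists>N. eventually (P N) (nhds x)"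
  shows "\<exists>N\<ge>0. \<forall>x\<in>J. P N x"
proof -
  have "\<forall>x\<in>J. \<exists>N U. open U \<and> x \<in> U \<and> (\<forall>y\<in>U. P N y)"
    using loc unfolding eventually_nhds by blast
  then obtain N U where U: "\<And>x. x \<in> J \<Longrightarrow> open (U x) \<and> x \<in> U x \<and> (\<forall>y\<in>U x. P (N x) y)"
    by metis
  obtain C where C: "C \<subseteq> J" "finite C" "J \<subseteq> (\<Union>x\<in>C. U x)"
    using compactE_image[OF \<open>compact J\<close>, of J U] U by blast
  define M where "M = Max (insert 0 (N ` C))"
  have "N c \<le> M" if "c \<in> C" for c using that C by (auto simp: M_def)
  then have "\<forall>x\<in>J. P M x" using C U mono by blast
  moreover have "M \<ge> 0" using C by (auto simp: M_def)
  ultimately show ?thesis by blast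
qed

lemma periodic_imp_bounded:
  fixes f :: "real \<Rightarrow> real"
  assumes per: "\<And>x. f (x + 1) = f x" and "continuous_on UNIV f"
  obtains M where "M > 0" "\<And>x. \<bar>f x\<bar> \<le> M"
proof -
  interpret periodic_fun_simple' f by standard (fact per)
  have "bounded (f ` {0..1})"
    by (intro compact_imp_bounded compact_continuous_image continuous_on_subset[OF assms(2)]) auto
  then obtain M where M: "M > 0" "\<And>x. x \<in> {0..1} \<Longrightarrow> \<bar>f x\<bar> \<le> M"
    unfolding bounded_pos by auto
  have "\<bar>f x\<bar> \<le> M" for x
  proof -
    have "f x = f (frac x)" using plus_of_int[of "frac x" "\<lfloor>x\<rfloor>"] by (simp add: frac_def)
    then show ?thesis using M(2)[of "frac x"] frac_lt_1[of x] by (auto simp: less_imp_le)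
  qed
  then show ?thesis using that M by blast
qed

lemma periodic_derivative:
  fixes f f' :: "real \<Rightarrow> real"
  assumes per: "\<And>x. f (x + 1) = f x" and der: "\<And>x. (f has_real_derivative f' x) (at x)"
  shows "f' (x + 1) = f' x"
proof -
  have "((\<lambda>x. f (x + 1)) has_real_derivative f' (x + 1)) (at x)"
    using der[of "x+1"] by (simp add: DERIV_shift)
  then show ?thesis using DERIV_unique der[of x] per by simp
qed

lemma upcrossing_periodic_positive:
  fixes f f' :: "real \<Rightarrow> real"
  assumes per: "\<And>x. f (x + 1) = f x"
    and der: "\<And>x. (f has_real_derivative f' x) (at x)"
    and up: "\<And>x. f x = 0 \<Longrightarrow> f' x > 0"
    and "f x0 \<ge> 0"
  shows "f x > 0"
proof -
  interpret periodic_fun_simple' f by standard (fact per)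
  obtain n :: nat where "x0 < x + real n" using reals_Archimedean2[of "x0 - x"] by (auto simp: algebra_simps)
  then have "f (x + real n) > 0"
    using upcrossing_stays_positive[of x0 "x + real n" f f'] assms by auto
  then show ?thesis by (simp add: plus_of_nat)
qed

text \<open>
  Comparing primitives replaces integrals of \<open>\<bar>f'\<bar>\<close>, so that no integrability of derivatives
  has to be discussed.
\<close>
lemma increments_dominated:
  fixes f g :: "real \<Rightarrow> real"
  assumes "a \<le> b"
    and f: "\<And>x. (f has_real_derivative f' x) (at x)"
    and g: "\<And>x. (g has_real_derivative g' x) (at x)"
    and dom: "\<And>x. a < x \<Longrightarrow> x < b \<Longrightarrow> \<bar>f' x\<bar> \<le> g' x"
  shows "\<bar>f b - f a\<bar> \<le> g b - g a"
proof -
  have c: "continuous_on {a..b} f" "continuous_on {a..b} g"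
    by (intro continuous_at_imp_continuous_on ballI DERIV_isCont[OF f] DERIV_isCont[OF g])+
  have "(\<lambda>x. g x - f x) a \<le> (\<lambda>x. g x - f x) b"
  proof (rule DERIV_nonneg_imp_increasing_open[OF \<open>a \<le> b\<close>])
    fix x assume "a < x" "x < b"
    then show "\<exists>y. ((\<lambda>x. g x - f x) has_real_derivative y) (at x) \<and> 0 \<le> y"
      using dom[of x] by (intro exI[of _ "g' x - f' x"]) (auto intro!: DERIV_diff f g)
  qed (intro continuous_intros c)
  moreover have "(\<lambda>x. g x + f x) a \<le> (\<lambda>x. g x + f x) b"
  proof (rule DERIV_nonneg_imp_increasing_open[OF \<open>a \<le> b\<close>])
    fix x assume "a < x" "x < b"
    then show "\<exists>y. ((\<lambda>x. g x + f x) has_real_derivative y) (at x) \<and> 0 \<le> y"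
      using dom[of x] by (intro exI[of _ "g' x + f' x"]) (auto intro!: DERIV_add f g)
  qed (intro continuous_intros c)
  ultimately show ?thesis by auto
qed

lemma second_order_quotient:
  fixes f f' :: "real \<Rightarrow> real"
  assumes f: "\<And>x. (f has_real_derivative f' x) (at x)"
    and f': "(f' has_real_derivative m) (at c)"
    and "f c = 0" "f' c = 0"
  shows "((\<lambda>x. f x / (x - c)\<^sup>2) \<longlongrightarrow> m / 2) (at c)"
    and "((\<lambda>x. f' x / (x - c)) \<longlongrightarrow> m) (at c)"
proof -
  show 1: "((\<lambda>x. f' x / (x - c)) \<longlongrightarrow> m) (at c)"
    using f' \<open>f' c = 0\<close> by (simp add: has_field_derivative_iff)
  show "((\<lambda>x. f x / (x - c)\<^sup>2) \<longlongrightarrow> m / 2) (at c)"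
  proof (rule lhopital)
    show "(f \<longlongrightarrow> 0) (at c)" using DERIV_isCont[OF f, of c] \<open>f c = 0\<close> by (simp add: isCont_def)
    show "((\<lambda>x. (x - c)\<^sup>2) \<longlongrightarrow> 0) (at c)" by (auto intro!: tendsto_eq_intros)
    have ne: "\<forall>\<^sub>F x in at c. x \<noteq> c" by (simp add: eventually_at_filter)
    show "\<forall>\<^sub>F x in at c. (x - c)\<^sup>2 \<noteq> 0" using ne by eventually_elim auto
    show "\<forall>\<^sub>F x in at c. 2 * (x - c) \<noteq> 0" using ne by eventually_elim auto
    show "\<forall>\<^sub>F x in at c. (f has_real_derivative f' x) (at x)" using f by simp
    show "\<forall>\<^sub>F x in at c. ((\<lambda>x. (x - c)\<^sup>2) has_real_derivative 2 * (x - c)) (at x)"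
      by (intro always_eventually allI) (auto intro!: derivative_eq_intros)
    show "((\<lambda>x. f' x / (2 * (x - c))) \<longlongrightarrow> m / 2) (at c)"
      using tendsto_divide[OF 1 tendsto_const[of 2]] by (simp add: field_simps)
  qed
qed

lemma polynomial_interpolation:
  fixes y :: "'a::field \<Rightarrow> 'a"
  assumes "finite Z"
  shows "\<exists>k. \<forall>z\<in>Z. poly k z = y z"
  using assms
proof (induction Z)
  case (insert c Z)
  then obtain k where k: "\<forall>z\<in>Z. poly k z = y z" by blast
  define N where "N = (\<Prod>z\<in>Z. [:- z, 1:])"
  have N: "poly N z = 0 \<longleftrightarrow> z \<in> Z" for z
    using insert.hyps by (auto simp: N_def poly_prod)
  have "\<forall>z\<in>insert c Z. poly (k + smult ((y c - poly k c) / poly N c) N) z = y z"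
    using k N insert.hyps by auto
  then show ?case by blast
qed auto

text \<open>
  Closeness of \<open>p\<^sup>2\<close> to \<open>s\<^sup>2\<close> gives closeness of \<open>p\<close> to \<open>s\<close>, with a constant that is uniform
  as \<open>s\<close> tends to zero, provided that \<open>p\<close> stays proportionally away from \<open>-s\<close>: then \<open>s + p\<close>
  and \<open>s - p\<close> are comparable when \<open>p\<close> is negative. The constant \<open>\<eta>\<close> absorbs an overshoot
  of \<open>p\<^sup>2\<close> above \<open>s\<^sup>2\<close>.
\<close>
lemma slope_defect:
  fixes p s \<rho> \<eta> :: real
  assumes "0 \<le> \<rho>" "\<rho> < 1" "0 \<le> s" "0 \<le> \<eta>" "p\<^sup>2 \<le> s\<^sup>2 + \<eta>" "- \<rho> * s \<le> p"
  shows "(p - s)\<^sup>2 \<le> 2 / (1 - \<rho>) * (s\<^sup>2 - p\<^sup>2 + 2 * \<eta>)"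
proof -
  have C: "2 / (1 - \<rho>) \<ge> 1" using assms by (simp add: field_simps)
  have fact: "(s - p) * (s + p) = s\<^sup>2 - p\<^sup>2" by (simp add: power2_eq_square algebra_simps)
  have absle: "\<bar>s\<^sup>2 - p\<^sup>2\<bar> \<le> s\<^sup>2 - p\<^sup>2 + 2 * \<eta>" using assms(4,5) by linarith
  show ?thesis
  proof (cases "p \<ge> 0")
    case True
    have "(p - s)\<^sup>2 = \<bar>s - p\<bar> * \<bar>s - p\<bar>" by (simp add: power2_eq_square algebra_simps)
    also have "\<dots> \<le> \<bar>s - p\<bar> * \<bar>s + p\<bar>" using True assms by (intro mult_left_mono) auto
    also have "\<dots> = \<bar>s\<^sup>2 - p\<^sup>2\<bar>" by (simp only: abs_mult[symmetric] fact)
    also have "\<dots> \<le> 1 * (s\<^sup>2 - p\<^sup>2 + 2 * \<eta>)" using absle by simp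
    also have "\<dots> \<le> 2 / (1 - \<rho>) * (s\<^sup>2 - p\<^sup>2 + 2 * \<eta>)"
      using C absle by (intro mult_right_mono) auto
    finally show ?thesis .
  next
    case False
    have "(1 - \<rho>) * (s - p) \<le> 2 * ((1 - \<rho>) * s)"
    proof -
      have "\<rho> * s \<le> s" using assms by (simp add: mult_left_le_one_le)
      then have "s - p \<le> 2 * s" using assms(6) by simp
      from mult_left_mono[OF this, of "1 - \<rho>"] show ?thesis using assms by (simp add: algebra_simps)
    qed
    also have "\<dots> \<le> 2 * (s + p)" using assms(6) by (simp add: algebra_simps)
    finally have "(1 - \<rho>) * (s - p) * (s - p) \<le> 2 * (s + p) * (s - p)"
      using False assms by (intro mult_right_mono) auto
    also have "\<dots> = 2 * (s\<^sup>2 - p\<^sup>2)" using fact by (simp add: algebra_simps)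
    also have "\<dots> \<le> 2 * (s\<^sup>2 - p\<^sup>2 + 2 * \<eta>)" using assms(4) by simp
    finally have "(1 - \<rho>) * (p - s)\<^sup>2 \<le> 2 * (s\<^sup>2 - p\<^sup>2 + 2 * \<eta>)"
      by (simp add: power2_eq_square algebra_simps)
    then show ?thesis using assms by (simp add: field_simps)
  qed
qed

lemma sqrt_excess:
  fixes u :: real
  assumes "\<eta> \<ge> 0" "u \<ge> 1"
  shows "sqrt (u\<^sup>2 + \<eta>) \<le> u + \<eta> / 2"
proof (rule real_le_lsqrt)
  have "\<eta> * 1 \<le> \<eta> * u" using assms by (intro mult_left_mono)
  then have "\<eta> \<le> \<eta> * u + \<eta> * \<eta> / 4" by (simp add: add_increasing2)
  then show "u\<^sup>2 + \<eta> \<le> (u + \<eta> / 2)\<^sup>2"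
    by (simp add: power2_eq_square algebra_simps)
qed (use assms in auto)

lemma eventually_right_mult_less:
  fixes N c :: real
  assumes "c > 0"
  shows "\<forall>\<^sub>F d in at_right 0. d * N < c"
proof -
  have "((\<lambda>d. d * N) \<longlongrightarrow> 0 * N) (at_right 0)" by (intro tendsto_intros)
  then show ?thesis using assms by (auto dest: order_tendstoD(2))
qed

text \<open>
  The values \<open>b < \<beta>\<close> sit strictly between the square root of the smallest curvature \<open>\<alpha>\<close> and those
  of the other curvatures: \<open>b\<close> bounds \<open>(1 - H) / d\<close> from above, and \<open>\<beta>\<close> is the slope of the
  falling barrier at the zeros.
\<close>
lemma curvature_separation:
  assumes "finite Z" "\<And>z. z \<in> Z \<Longrightarrow> g z > \<alpha>" "\<alpha> \<ge> (0::real)"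
  obtains m b \<beta> where "\<And>z. z \<in> Z \<Longrightarrow> m \<le> g z" "0 < b" "\<alpha> < b\<^sup>2" "b < \<beta>" "\<beta>\<^sup>2 < m"
proof -
  define m where "m = Min (insert (\<alpha> + 1) (g ` Z))"
  have "m > \<alpha>" using assms by (auto simp: m_def)
  have "sqrt \<alpha> < sqrt m" using \<open>m > \<alpha>\<close> by simp
  then obtain b where b: "sqrt \<alpha> < b" "b < sqrt m" using dense by blast
  obtain \<beta> where \<beta>: "b < \<beta>" "\<beta> < sqrt m" using b dense by blast
  have "0 \<le> sqrt \<alpha>" using assms by simp
  then have "0 < b" using b by linarith
  moreover have "\<alpha> < b\<^sup>2" using b \<open>0 < b\<close> by (metis abs_of_pos real_sqrt_abs real_sqrt_less_iff)
  moreover have "\<beta>\<^sup>2 < m" using \<beta> \<open>0 < b\<close>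
    by (metis abs_of_pos less_trans real_sqrt_abs real_sqrt_less_iff)
  moreover have "m \<le> g z" if "z \<in> Z" for z using that assms by (auto simp: m_def)
  ultimately show ?thesis using that \<beta> by blast
qed

section \<open>The tilted equation and its barriers\<close>

locale potential =
  fixes v v1 v2 :: "real \<Rightarrow> real"
  assumes v_deriv: "\<And>x. (v has_real_derivative v1 x) (at x)"
    and v1_deriv: "\<And>x. (v1 has_real_derivative v2 x) (at x)"
    and v2_cont: "continuous_on UNIV v2"
    and v_periodic: "\<And>x. v (x + 1) = v x"
    and v_nonpos: "\<And>x. v x \<le> 0"
begin

text \<open>
  The cell problem in terms of \<open>W x = w x + \<mu> x\<close>, its slope \<open>p\<close> and \<open>q = p'\<close>. The equation
  is multiplied by \<open>1 + p\<^sup>2\<close>, which makes it explicit in \<open>q\<close>.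
\<close>
definition tilted :: "real \<Rightarrow> real \<Rightarrow> real \<Rightarrow> (real \<Rightarrow> real) \<Rightarrow> (real \<Rightarrow> real) \<Rightarrow> (real \<Rightarrow> real) \<Rightarrow> bool"
  where "tilted d \<mu> H W p q \<longleftrightarrow>
    (\<forall>x. W (x + 1) = W x + \<mu>) \<and> (\<forall>x. (W has_real_derivative p x) (at x)) \<and>
    (\<forall>x. (p has_real_derivative q x) (at x)) \<and>
    (\<forall>x. d * q x = (1 + (p x)\<^sup>2) * (sqrt (1 + (p x)\<^sup>2) + v x - H))"

lemma tiltedD:
  assumes "tilted d \<mu> H W p q"
  shows "W (x + 1) = W x + \<mu>" "(W has_real_derivative p x) (at x)"
    "(p has_real_derivative q x) (at x)"
    "d * q x = (1 + (p x)\<^sup>2) * (sqrt (1 + (p x)\<^sup>2) + v x - H)"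
    "p (x + 1) = p x"
proof -
  show W: "W (x + 1) = W x + \<mu>" "(W has_real_derivative p x) (at x)" 
    "(p has_real_derivative q x) (at x)"
    "d * q x = (1 + (p x)\<^sup>2) * (sqrt (1 + (p x)\<^sup>2) + v x - H)" for x
    using assms by (auto simp: tilted_def)
  have "((\<lambda>x. W x - \<mu> * x) has_real_derivative p x - \<mu>) (at x)" for x
    by (auto intro!: derivative_eq_intros W)
  then have "p (x + 1) - \<mu> = p x - \<mu>"
    by (rule periodic_derivative[rotated]) (simp add: W algebra_simps)
  then show "p (x + 1) = p x" by simp
qed

lemma v1_periodic: "v1 (x + 1) = v1 x"
  by (rule periodic_derivative[OF v_periodic v_deriv])

lemma v2_periodic: "v2 (x + 1) = v2 x"
  by (rule periodic_derivative[OF v1_periodic v1_deriv])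

lemma v_cont: "continuous_on S v" and v1_cont: "continuous_on S v1"
  by (intro continuous_at_imp_continuous_on ballI DERIV_isCont[OF v_deriv]
      DERIV_isCont[OF v1_deriv])+

lemma zero_critical:
  assumes "v c = 0" shows "v1 c = 0"
  by (rule DERIV_local_max[OF v_deriv, of 1]) (use v_nonpos assms in auto)

lemma slope_sq: "(slope v x)\<^sup>2 = (1 - v x)\<^sup>2 - 1"
  and slope_nonneg: "slope v x \<ge> 0"
  and slope_eikonal: "sqrt (1 + (slope v x)\<^sup>2) = 1 - v x"
proof -
  have "(1 - v x)\<^sup>2 \<ge> 1" using v_nonpos[of x] by simp
  then show 1: "(slope v x)\<^sup>2 = (1 - v x)\<^sup>2 - 1" "slope v x \<ge> 0" by (auto simp: slope_def)
  show "sqrt (1 + (slope v x)\<^sup>2) = 1 - v x" using v_nonpos[of x] by (simp add: 1)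
qed

text \<open>
  How far a slope \<open>P\<close> is from solving the inviscid equation, in terms of squares; all
  estimates of \<open>sqrt (1 + P\<^sup>2) + v - 1\<close> come from this factorisation.
\<close>
lemma hamiltonian_gap:
  "(sqrt (1 + P\<^sup>2) - (1 - v x)) * (sqrt (1 + P\<^sup>2) + (1 - v x)) = P\<^sup>2 - (slope v x)\<^sup>2"
proof -
  have "(a - b) * (a + b) = a\<^sup>2 - b\<^sup>2" for a b :: real by (simp add: power2_eq_square algebra_simps)
  then show ?thesis by (simp add: slope_sq)
qed

lemma slope_periodic: "slope v (x + 1) = slope v x"
  by (simp add: slope_def v_periodic)

lemma slope_cont: "continuous_on S (slope v)"
  unfolding slope_def by (intro continuous_intros v_cont)

lemma slope_zero_iff: "slope v x = 0 \<longleftrightarrow> v x = 0"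
  using slope_eikonal[of x] slope_sq[of x] v_nonpos[of x] by (auto simp: power2_eq_1_iff)

lemma slope_sq_deriv:
  "((\<lambda>x. (slope v x)\<^sup>2) has_real_derivative - 2 * (1 - v x) * v1 x) (at x)"
  unfolding slope_sq by (auto intro!: derivative_eq_intros v_deriv simp: algebra_simps)

lemma slope_primitive:
  obtains A where "\<And>x. (A has_real_derivative slope v x) (at x)" "A c = 0"
    "\<And>a b. a \<le> b \<Longrightarrow> integral {a..b} (slope v) = A b - A a"
    "\<And>x. A (x + 1) = A x + integral {0..1} (slope v)"
proof -
  have "\<exists>F. \<forall>x. - \<infinity> < ereal x \<longrightarrow> ereal x < \<infinity> \<longrightarrow> (F has_vector_derivative slope v x) (at x)"
    by (rule einterval_antiderivative)
      (use slope_cont[of UNIV] in \<open>auto simp: continuous_on_eq_continuous_at\<close>)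
  then obtain F where F: "\<And>x. (F has_real_derivative slope v x) (at x)"
    by (auto simp: has_real_derivative_iff_has_vector_derivative)
  have int: "integral {a..b} (slope v) = F b - F a" if "a \<le> b" for a b
    by (rule integral_unique, rule fundamental_theorem_of_calculus[OF that])
      (use F in \<open>auto simp: has_real_derivative_iff_has_vector_derivative
         intro: has_vector_derivative_at_within\<close>)
  have "((\<lambda>x. F (x + 1) - F x) has_real_derivative 0) (at x)" for x
  proof -
    have "((\<lambda>x. F (x + 1)) has_real_derivative slope v x) (at x)"
      using F[of "x + 1"] by (simp add: DERIV_shift slope_periodic)
    from DERIV_diff[OF this F[of x]] show ?thesis by simp
  qed
  then have "F (x + 1) - F x = F (0 + 1) - F 0" for x
    using DERIV_isconst_all by blast
  then have per: "F (x + 1) - F x = integral {0..1} (slope v)" for x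
    using int[of 0 1] by simp
  show ?thesis
  proof (rule that[of "\<lambda>x. F x - F c"])
    show "F (x + 1) - F c = F x - F c + integral {0..1} (slope v)" for x
      using per[of x] by simp
  qed (use int in \<open>auto intro!: derivative_eq_intros F\<close>)
qed

text \<open>
  At a contact point \<open>p = B\<close> the equation evaluates \<open>p'\<close> with \<open>B\<close> in place of \<open>p\<close>, so the
  inequality for \<open>B\<close> fixes the direction of the crossing. Read backwards, the same statement
  confines \<open>p\<close> to the left of a contact point.
\<close>
lemma barrier_above:
  assumes T: "tilted d \<mu> H W p q" and "d > 0" "a < b" "B a \<le> p a"
    and B: "\<And>x. x \<in> {a..b} \<Longrightarrow> (B has_real_derivative B1 x) (at x)"
    and sub: "\<And>x. x \<in> {a..b} \<Longrightarrow> d * B1 x < (1 + (B x)\<^sup>2) * (sqrt (1 + (B x)\<^sup>2) + v x - H)"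
  shows "B b < p b"
proof -
  have "0 < p b - B b"
  proof (rule upcrossing_stays_positive[where f = "\<lambda>x. p x - B x" and f' = "\<lambda>x. q x - B1 x"])
    fix x assume x: "x \<in> {a..b}"
    show "((\<lambda>x. p x - B x) has_real_derivative q x - B1 x) (at x)"
      by (intro DERIV_diff B x tiltedD(3)[OF T])
    assume "p x - B x = 0"
    then have "d * B1 x < d * q x" using sub[OF x] tiltedD(4)[OF T, of x] by simp
    then show "0 < q x - B1 x" using \<open>d > 0\<close> by simp
  qed (use assms in auto)
  then show ?thesis by simp
qed

lemma barrier_below:
  assumes T: "tilted d \<mu> H W p q" and "d > 0" "a < b" "p a \<le> B a"
    and B: "\<And>x. x \<in> {a..b} \<Longrightarrow> (B has_real_derivative B1 x) (at x)"
    and super: "\<And>x. x \<in> {a..b} \<Longrightarrow> d * B1 x > (1 + (B x)\<^sup>2) * (sqrt (1 + (B x)\<^sup>2) + v x - H)"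
  shows "p b < B b"
proof -
  have "0 < B b - p b"
  proof (rule upcrossing_stays_positive[where f = "\<lambda>x. B x - p x" and f' = "\<lambda>x. B1 x - q x"])
    fix x assume x: "x \<in> {a..b}"
    show "((\<lambda>x. B x - p x) has_real_derivative B1 x - q x) (at x)"
      by (intro DERIV_diff B x tiltedD(3)[OF T])
    assume "B x - p x = 0"
    then have "d * B1 x > d * q x" using super[OF x] tiltedD(4)[OF T, of x] by simp
    then show "0 < B1 x - q x" using \<open>d > 0\<close> by simp
  qed (use assms in auto)
  then show ?thesis by simp
qed

lemma periodic_barrier_above:
  assumes T: "tilted d \<mu> H W p q" and "d > 0" "B x0 \<le> p x0"
    and "\<And>x. B (x + 1) = B x"
    and B: "\<And>x. (B has_real_derivative B1 x) (at x)"
    and sub: "\<And>x. d * B1 x < (1 + (B x)\<^sup>2) * (sqrt (1 + (B x)\<^sup>2) + v x - H)"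
  shows "B x < p x"
proof -
  have "0 < p x - B x"
  proof (rule upcrossing_periodic_positive[where f = "\<lambda>x. p x - B x" and f' = "\<lambda>x. q x - B1 x" and ?x0.0 = x0])
    fix x
    show "((\<lambda>x. p x - B x) has_real_derivative q x - B1 x) (at x)"
      by (intro DERIV_diff B tiltedD(3)[OF T])
    assume "p x - B x = 0"
    then have "d * B1 x < d * q x" using sub[of x] tiltedD(4)[OF T, of x] by simp
    then show "0 < q x - B1 x" using \<open>d > 0\<close> by simp
  qed (use assms tiltedD(5)[OF T] in auto)
  then show ?thesis by simp
qed

lemma periodic_barrier_below:
  assumes T: "tilted d \<mu> H W p q" and "d > 0" "p x0 \<le> B x0"
    and "\<And>x. B (x + 1) = B x"
    and B: "\<And>x. (B has_real_derivative B1 x) (at x)"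
    and super: "\<And>x. d * B1 x > (1 + (B x)\<^sup>2) * (sqrt (1 + (B x)\<^sup>2) + v x - H)"
  shows "p x < B x"
proof -
  have "0 < B x - p x"
  proof (rule upcrossing_periodic_positive[where f = "\<lambda>x. B x - p x" and f' = "\<lambda>x. B1 x - q x" and ?x0.0 = x0])
    fix x
    show "((\<lambda>x. B x - p x) has_real_derivative B1 x - q x) (at x)"
      by (intro DERIV_diff B tiltedD(3)[OF T])
    assume "B x - p x = 0"
    then have "d * B1 x > d * q x" using super[of x] tiltedD(4)[OF T, of x] by simp
    then show "0 < B1 x - q x" using \<open>d > 0\<close> by simp
  qed (use assms tiltedD(5)[OF T] in auto)
  then show ?thesis by simp
qed

text \<open>
  The only place where the smallness of \<open>\<mu>\<close> acts: a slope beyond \<open>s\<close> (or \<open>-s\<close>) throughout a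
  period would have too large a mean.
\<close>
lemma mean_slope_bound:
  assumes T: "tilted d \<mu> H W p q" and small: "\<bar>\<mu>\<bar> < integral {0..1} (slope v)"
  shows "\<exists>x\<in>{a<..<a+1}. p x < slope v x" "\<exists>x\<in>{a<..<a+1}. p x > - slope v x"
proof -
  obtain A where A: "\<And>x. (A has_real_derivative slope v x) (at x)"
    "\<And>x. A (x + 1) = A x + integral {0..1} (slope v)"
    using slope_primitive by metis
  show "\<exists>x\<in>{a<..<a+1}. p x < slope v x"
  proof (rule ccontr)
    assume "\<not> ?thesis"
    then have "\<bar>A (a + 1) - A a\<bar> \<le> W (a + 1) - W a"
      by (intro increments_dominated[OF _ A(1) tiltedD(2)[OF T]])
        (auto simp: not_less abs_of_nonneg[OF slope_nonneg] Ball_def le_minus_iff[of "p _"])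
    then show False using small A(2)[of a] tiltedD(1)[OF T, of a] by auto
  qed
  show "\<exists>x\<in>{a<..<a+1}. p x > - slope v x"
  proof (rule ccontr)
    assume "\<not> ?thesis"
    then have "\<bar>A (a + 1) - A a\<bar> \<le> - W (a + 1) - - W a"
      by (intro increments_dominated[OF _ A(1) DERIV_minus[OF tiltedD(2)[OF T]]])
        (auto simp: not_less abs_of_nonneg[OF slope_nonneg] Ball_def le_minus_iff[of "p _"])
    then show False using small A(2)[of a] tiltedD(1)[OF T, of a] by auto
  qed
qed

text \<open>
  The inviscid slope has a corner at every zero of \<open>v\<close>. Adding \<open>\<eta>\<close> under the root smooths it,
  and keeps its derivative bounded on the line.
\<close>
lemma raised_slope_barrier:
  fixes \<eta> :: real
  assumes "\<eta> > 0"
  obtains B B1 M where "M > 0" "\<And>x. (B has_real_derivative B1 x) (at x)" "\<And>x. \<bar>B1 x\<bar> \<le> M"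
    "\<And>x. B (x + 1) = B x" "\<And>x. (B x)\<^sup>2 = (slope v x)\<^sup>2 + \<eta>" "\<And>x. B x > slope v x"
proof -
  define B where "B = (\<lambda>x. sqrt ((slope v x)\<^sup>2 + \<eta>))"
  define B1 where "B1 = (\<lambda>x. - ((1 - v x) * v1 x) / B x)"
  have pos: "(slope v x)\<^sup>2 + \<eta> > 0" for x using assms by (simp add: add_nonneg_pos)
  then have B_ne: "B x \<noteq> 0" for x by (simp add: B_def less_le)
  have D: "(B has_real_derivative B1 x) (at x)" for x
  proof -
    have "((\<lambda>x. (slope v x)\<^sup>2 + \<eta>) has_real_derivative - 2 * (1 - v x) * v1 x) (at x)"
      using DERIV_add[OF slope_sq_deriv DERIV_const[of \<eta>]] by simp
    from DERIV_chain2[OF DERIV_real_sqrt[OF pos[of x]] this]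
    have "(B has_real_derivative inverse (B x) / 2 * (- 2 * (1 - v x) * v1 x)) (at x)"
      by (simp add: B_def)
    moreover have "inverse s / 2 * (- 2 * a * b) = - (a * b) / s" for s a b :: real
      by (cases "s = 0") (simp_all add: field_simps)
    ultimately show ?thesis by (simp only: B1_def)
  qed
  have cont: "continuous_on UNIV B"
    by (intro continuous_at_imp_continuous_on ballI DERIV_isCont[OF D])
  have "continuous_on UNIV B1"
    unfolding B1_def by (intro continuous_intros v_cont v1_cont cont ballI B_ne)
  moreover have "B1 (x + 1) = B1 x" for x
    by (simp add: B1_def B_def v_periodic v1_periodic slope_periodic)
  ultimately obtain M where M: "M > 0" "\<And>x. \<bar>B1 x\<bar> \<le> M"
    using periodic_imp_bounded[of B1] by blast
  have "B x > slope v x" for x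
    unfolding B_def using assms by (intro real_less_rsqrt) auto
  moreover have "(B x)\<^sup>2 = (slope v x)\<^sup>2 + \<eta>" for x using pos[of x] by (simp add: B_def)
  moreover have "B (x + 1) = B x" for x by (simp add: B_def slope_periodic)
  ultimately show ?thesis by (intro that[of M B B1] M D)
qed

text \<open>
  If \<open>H\<close> were at least \<open>1 + \<eta>\<close>, then \<open>B = sqrt (s\<^sup>2 + \<eta>)\<close> would satisfy \<open>F B + v < H\<close> with room
  to spare, and both \<open>B\<close> and \<open>-B\<close> could only be crossed downwards. By periodicity they are not
  crossed at all. Outside \<open>(-B, B)\<close> the mean is too large; inside, \<open>p' < 0\<close> everywhere, which
  is impossible for a periodic function.
\<close>
lemma energy_upper_bound:
  assumes "\<eta> > 0" and small: "\<bar>\<mu>\<bar> < integral {0..1} (slope v)"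
  shows "\<forall>\<^sub>F d in at_right 0. \<forall>H W p q. tilted d \<mu> H W p q \<longrightarrow> H < 1 + \<eta>"
proof -
  obtain B B1 M where B: "M > 0" "\<And>x. (B has_real_derivative B1 x) (at x)" "\<And>x. \<bar>B1 x\<bar> \<le> M"
    "\<And>x. B (x + 1) = B x" "\<And>x. (B x)\<^sup>2 = (slope v x)\<^sup>2 + \<eta>" "\<And>x. B x > slope v x"
    using raised_slope_barrier[OF \<open>\<eta> > 0\<close>] by metis
  have "\<forall>\<^sub>F d in at_right (0::real). d < \<eta> / (2 * M)" "\<forall>\<^sub>F d in at_right (0::real). d > 0"
    using B(1) assms(1) by (auto simp: eventually_at_right_less intro!: eventually_at_rightI[of 0 "\<eta> / (2 * M)"])
  then show ?thesis
  proof eventually_elim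
    case (elim d)
    then have dM: "d * M < \<eta> / 2" using B(1) by (simp add: field_simps)
    show ?case
    proof (intro allI impI, rule ccontr)
      fix H W p q assume T: "tilted d \<mu> H W p q" and "\<not> H < 1 + \<eta>"
      then have H: "H \<ge> 1 + \<eta>" by simp
      have E: "sqrt (1 + (B x)\<^sup>2) + v x - H \<le> - \<eta> / 2" for x
        using sqrt_excess[of \<eta> "1 - v x"] v_nonpos[of x] H \<open>\<eta> > 0\<close> by (simp add: B(5) slope_sq)
      have E': "(1 + (B x)\<^sup>2) * (sqrt (1 + (B x)\<^sup>2) + v x - H) \<le> - \<eta> / 2" for x
      proof -
        have "(1 + (B x)\<^sup>2) * (sqrt (1 + (B x)\<^sup>2) + v x - H) \<le> 1 * (sqrt (1 + (B x)\<^sup>2) + v x - H)"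
          using E[of x] \<open>\<eta> > 0\<close> by (intro mult_right_mono_neg) auto
        with E[of x] show ?thesis by simp
      qed
      have dB: "\<bar>d * B1 x\<bar> < \<eta> / 2" for x
      proof -
        have "\<bar>d * B1 x\<bar> \<le> d * M" using B(3)[of x] \<open>0 < d\<close> by (simp add: abs_mult)
        with dM show ?thesis by simp
      qed
      have up: "p x < B x" for x
      proof (rule ccontr)
        assume n: "\<not> p x < B x"
        have "B y \<le> p y" for y
        proof (rule ccontr)
          assume "\<not> B y \<le> p y"
          then have "p x < B x"
          proof (intro periodic_barrier_below[OF T \<open>0 < d\<close> _ B(4) B(2), of y])
            fix y
            show "(1 + (B y)\<^sup>2) * (sqrt (1 + (B y)\<^sup>2) + v y - H) < d * B1 y"
              using dB[of y] E'[of y] by simp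
          qed auto
          then show False using n by simp
        qed
        moreover obtain y where "p y < slope v y" using mean_slope_bound(1)[OF T small] by blast
        ultimately show False using B(6)[of y] by (meson less_le_trans less_asym)
      qed
      have lo: "p x > - B x" for x
      proof (rule ccontr)
        assume n: "\<not> p x > - B x"
        have "p y < - B y" for y
        proof (rule periodic_barrier_below[OF T \<open>0 < d\<close> _ _ DERIV_minus[OF B(2)], of x])
          fix y
          show "(1 + (- B y)\<^sup>2) * (sqrt (1 + (- B y)\<^sup>2) + v y - H) < d * - B1 y"
            using dB[of y] E'[of y] by simp
        qed (use n B(4) in auto)
        moreover obtain y where "p y > - slope v y" using mean_slope_bound(2)[OF T small] by blast
        ultimately show False using B(6)[of y] by (smt (verit))
      qed
      \<comment> \<open>between the barriers \<open>F p \<le> F B\<close>, so the slope decreases strictly\<close>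
      have qneg: "q x < 0" for x
      proof -
        have "(p x)\<^sup>2 \<le> (B x)\<^sup>2" using up[of x] lo[of x] by (intro abs_le_square_iff[THEN iffD1]) auto
        then have "sqrt (1 + (p x)\<^sup>2) \<le> sqrt (1 + (B x)\<^sup>2)" by simp
        then have "sqrt (1 + (p x)\<^sup>2) + v x - H < 0" using E[of x] \<open>\<eta> > 0\<close> by linarith
        then have "d * q x < 0" unfolding tiltedD(4)[OF T]
          by (intro mult_pos_neg) (auto simp: add_pos_nonneg)
        then show ?thesis using \<open>0 < d\<close> by (simp add: mult_less_0_iff)
      qed
      have "p (0 + 1) < p 0"
        by (rule DERIV_neg_imp_decreasing) (use qneg tiltedD(3)[OF T] in auto)
      then show False using tiltedD(5)[OF T, of 0] by simp
    qed
  qed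
qed

text \<open>
  Once \<open>H\<close> is close to \<open>1\<close>, the same barriers satisfy \<open>F B + v > H\<close> and can only be crossed
  upwards, hence are not crossed at all; a slope outside them has too large a mean.
\<close>
lemma slope_confinement:
  assumes "\<eta> > 0" and small: "\<bar>\<mu>\<bar> < integral {0..1} (slope v)"
  shows "\<forall>\<^sub>F d in at_right 0. \<forall>H W p q. tilted d \<mu> H W p q \<longrightarrow> (\<forall>x. (p x)\<^sup>2 \<le> (slope v x)\<^sup>2 + \<eta>)"
proof -
  obtain B B1 M where B: "M > 0" "\<And>x. (B has_real_derivative B1 x) (at x)" "\<And>x. \<bar>B1 x\<bar> \<le> M"
    "\<And>x. B (x + 1) = B x" "\<And>x. (B x)\<^sup>2 = (slope v x)\<^sup>2 + \<eta>" "\<And>x. B x > slope v x"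
    using raised_slope_barrier[OF \<open>\<eta> > 0\<close>] by metis
  have cont: "continuous_on UNIV B"
    by (intro continuous_at_imp_continuous_on ballI DERIV_isCont[OF B(2)])
  obtain N where N: "N > 0" "\<And>x. \<bar>sqrt (1 + (B x)\<^sup>2) + (1 - v x)\<bar> \<le> N"
    by (rule periodic_imp_bounded[of "\<lambda>x. sqrt (1 + (B x)\<^sup>2) + (1 - v x)"])
      (auto simp: B(4) v_periodic intro!: continuous_intros cont v_cont)
  define \<kappa> where "\<kappa> = \<eta> / (2 * N)"
  have "\<kappa> > 0" using N \<open>\<eta> > 0\<close> by (simp add: \<kappa>_def)
  have E: "sqrt (1 + (B x)\<^sup>2) + v x - 1 \<ge> 2 * \<kappa>" for x
  proof -
    let ?s = "sqrt (1 + (B x)\<^sup>2)"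
    have eq: "(?s - (1 - v x)) * (?s + (1 - v x)) = \<eta>" by (subst hamiltonian_gap) (simp add: B(5))
    have "?s + (1 - v x) > 0" using v_nonpos[of x] by (simp add: add_pos_nonneg add_nonneg_pos)
    then have "?s - (1 - v x) = \<eta> / (?s + (1 - v x))" using eq by (simp add: field_simps)
    also have "\<dots> \<ge> \<eta> / N"
      using N(2)[of x] \<open>\<eta> > 0\<close> \<open>?s + (1 - v x) > 0\<close> by (intro divide_left_mono) auto
    finally show ?thesis by (simp add: \<kappa>_def)
  qed
  have "\<forall>\<^sub>F d in at_right (0::real). d < \<kappa> / M" "\<forall>\<^sub>F d in at_right (0::real). d > 0"
    using B(1) \<open>\<kappa> > 0\<close> by (auto simp: eventually_at_right_less intro!: eventually_at_rightI[of 0 "\<kappa> / M"])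
  with energy_upper_bound[OF \<open>\<kappa> > 0\<close> small] show ?thesis
  proof eventually_elim
    case (elim d)
    then have dM: "d * M < \<kappa>" using B(1) by (simp add: field_simps)
    show ?case
    proof (intro allI impI)
      fix H W p q x assume T: "tilted d \<mu> H W p q"
      then have H: "H < 1 + \<kappa>" using elim by blast
      have sub: "\<bar>d * B1 x\<bar> < (1 + (B x)\<^sup>2) * (sqrt (1 + (B x)\<^sup>2) + v x - H)" for x
      proof -
        have "\<bar>d * B1 x\<bar> \<le> d * M" using B(3)[of x] \<open>0 < d\<close> by (simp add: abs_mult)
        also have "\<dots> < 1 * \<kappa>" using dM by simp
        also have "\<dots> \<le> (1 + (B x)\<^sup>2) * (sqrt (1 + (B x)\<^sup>2) + v x - H)"
          using E[of x] H \<open>\<kappa> > 0\<close> by (intro mult_mono) auto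
        finally show ?thesis .
      qed
      have up: "p x < B x" for x
      proof (rule ccontr)
        assume n: "\<not> p x < B x"
        have "B y < p y" for y
          using n sub by (intro periodic_barrier_above[OF T \<open>0 < d\<close> _ B(4) B(2), of x])
            (auto simp: abs_less_iff)
        moreover obtain y where "p y < slope v y" using mean_slope_bound(1)[OF T small] by blast
        ultimately show False using B(6)[of y] by (smt (verit))
      qed
      have lo: "p x > - B x" for x
      proof (rule ccontr)
        assume n: "\<not> p x > - B x"
        have "p y \<le> - B y" for y
        proof (rule ccontr)
          assume "\<not> p y \<le> - B y"
          then have "- B x < p x"
            using sub B(4) by (intro periodic_barrier_above[OF T \<open>0 < d\<close> _ _ DERIV_minus[OF B(2)], of y])
              (auto simp: abs_less_iff)
          then show False using n by simp
        qed
        moreover obtain y where "p y > - slope v y" using mean_slope_bound(2)[OF T small] by blast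
        ultimately show False using B(6)[of y] by (smt (verit))
      qed
      have "(p x)\<^sup>2 \<le> (B x)\<^sup>2" using up[of x] lo[of x] by (intro abs_le_square_iff[THEN iffD1]) auto
      then show "(p x)\<^sup>2 \<le> (slope v x)\<^sup>2 + \<eta>" by (simp add: B(5))
    qed
  qed
qed

section \<open>Lower bound on the effective Hamiltonian\<close>

lemma slope_at_zero:
  assumes "v c = 0"
  shows "((\<lambda>x. (slope v x)\<^sup>2 / (x - c)\<^sup>2) \<longlongrightarrow> - v2 c) (at c)"
    and "((\<lambda>x. v1 x / (x - c)) \<longlongrightarrow> v2 c) (at c)"
    and "v2 c \<le> 0"
proof -
  have "((\<lambda>x. - 2 * (1 - v x) * v1 x) has_real_derivative - 2 * v2 c) (at c)"
    using zero_critical[OF assms] assms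
    by (auto intro!: derivative_eq_intros v_deriv v1_deriv)
  from second_order_quotient(1)[OF slope_sq_deriv this] zero_critical[OF assms] assms
  show 1: "((\<lambda>x. (slope v x)\<^sup>2 / (x - c)\<^sup>2) \<longlongrightarrow> - v2 c) (at c)"
    by (simp add: slope_sq)
  show "((\<lambda>x. v1 x / (x - c)) \<longlongrightarrow> v2 c) (at c)"
    by (rule second_order_quotient(2)[OF v_deriv v1_deriv assms zero_critical[OF assms]])
  have "0 \<le> - v2 c" by (rule tendsto_lowerbound[OF 1]) auto
  then show "v2 c \<le> 0" by simp
qed

text \<open>
  A line of slope \<open>b\<close> lies above the inviscid slope near \<open>c\<close> because \<open>s\<^sup>2\<close> behaves like
  \<open>- v'' c (x - c)\<^sup>2\<close>; the cubic term keeps it above on the rest of the two periods around \<open>c\<close>.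
  The surplus \<open>\<kappa> (x - c)\<^sup>2\<close> is there to pay for the derivative of that term.
\<close>
lemma cubic_above_slope:
  assumes "v c = 0" and "b > 0" "b\<^sup>2 > - v2 c"
  obtains K \<kappa> where "K \<ge> 0" "\<kappa> > 0"
    "\<And>x. \<bar>x - c\<bar> \<le> 1 \<Longrightarrow>
       (slope v x)\<^sup>2 + \<kappa> * (x - c)\<^sup>2 \<le> (b * (x - c) + K * (x - c) ^ 3)\<^sup>2"
proof -
  define \<kappa> where "\<kappa> = (b\<^sup>2 - - v2 c) / 2"
  have "\<kappa> > 0" using assms by (simp add: \<kappa>_def)
  have "\<exists>N\<ge>0. \<forall>x\<in>{c-1..c+1}. (slope v x)\<^sup>2 + \<kappa> * (x - c)\<^sup>2 \<le> b\<^sup>2 * (x - c)\<^sup>2 + N * (x - c) ^ 4"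
  proof (rule compact_local_threshold)
    fix N N' x :: real
    assume "N \<le> N'"
    then have "N * (x - c) ^ 4 \<le> N' * (x - c) ^ 4" by (intro mult_right_mono) auto
    then show "(slope v x)\<^sup>2 + \<kappa> * (x - c)\<^sup>2 \<le> b\<^sup>2 * (x - c)\<^sup>2 + N * (x - c) ^ 4 \<Longrightarrow>
      (slope v x)\<^sup>2 + \<kappa> * (x - c)\<^sup>2 \<le> b\<^sup>2 * (x - c)\<^sup>2 + N' * (x - c) ^ 4" by simp
  next
    fix x :: real
    show "\<exists>N. \<forall>\<^sub>F x in nhds x. (slope v x)\<^sup>2 + \<kappa> * (x - c)\<^sup>2 \<le> b\<^sup>2 * (x - c)\<^sup>2 + N * (x - c) ^ 4"
    proof (cases "x = c")
      case True
      have "- v2 c < b\<^sup>2 - \<kappa>" using assms by (simp add: \<kappa>_def field_simps)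
      then have "\<forall>\<^sub>F x in at c. (slope v x)\<^sup>2 / (x - c)\<^sup>2 < b\<^sup>2 - \<kappa>"
        by (rule order_tendstoD(2)[OF slope_at_zero(1)[OF assms(1)]])
      moreover have "\<forall>\<^sub>F x in at c. x \<noteq> c" by (simp add: eventually_at_filter)
      ultimately have "\<forall>\<^sub>F x in at c. (slope v x)\<^sup>2 + \<kappa> * (x - c)\<^sup>2 \<le> b\<^sup>2 * (x - c)\<^sup>2 + 0 * (x - c) ^ 4"
        by eventually_elim (simp add: field_simps)
      then show ?thesis using assms(1)
        by (intro exI[of _ 0]) (simp add: eventually_nhds_conv_at True slope_sq)
    next
      case False
      define N where "N = ((slope v x)\<^sup>2 + \<kappa> * (x - c)\<^sup>2) / (x - c) ^ 4 + 1"
      have "isCont (\<lambda>x. b\<^sup>2 * (x - c)\<^sup>2 + N * (x - c) ^ 4 - ((slope v x)\<^sup>2 + \<kappa> * (x - c)\<^sup>2)) x"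
        using slope_cont[of UNIV] by (auto intro!: continuous_intros simp: continuous_on_eq_continuous_at)
      moreover have "N * (x - c) ^ 4 = (slope v x)\<^sup>2 + \<kappa> * (x - c)\<^sup>2 + (x - c) ^ 4"
        using False by (simp add: N_def field_simps)
      then have "0 < b\<^sup>2 * (x - c)\<^sup>2 + N * (x - c) ^ 4 - ((slope v x)\<^sup>2 + \<kappa> * (x - c)\<^sup>2)"
        using False by (simp add: add_nonneg_pos)
      ultimately have "\<forall>\<^sub>F x in nhds x. 0 < b\<^sup>2 * (x - c)\<^sup>2 + N * (x - c) ^ 4 - ((slope v x)\<^sup>2 + \<kappa> * (x - c)\<^sup>2)"
        by (rule isCont_eventually_pos)
      then show ?thesis by (intro exI[of _ N]) (auto elim: eventually_mono)
    qed
  qed auto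
  then obtain N where N: "N \<ge> 0" "\<And>x. \<bar>x - c\<bar> \<le> 1 \<Longrightarrow>
      (slope v x)\<^sup>2 + \<kappa> * (x - c)\<^sup>2 \<le> b\<^sup>2 * (x - c)\<^sup>2 + N * (x - c) ^ 4"
    by (auto simp: abs_le_iff)
  show ?thesis
  proof (rule that[of "N / (2 * b)" \<kappa>])
    fix x assume x: "\<bar>x - c\<bar> \<le> 1"
    have "(b * y + K * y ^ 3)\<^sup>2 = b\<^sup>2 * y\<^sup>2 + 2 * b * K * y ^ 4 + (K * y ^ 3)\<^sup>2" for y K :: real
      by (simp add: power2_eq_square algebra_simps eval_nat_numeral)
    from this[of "x - c" "N / (2 * b)"]
    have "b\<^sup>2 * (x - c)\<^sup>2 + N * (x - c) ^ 4 \<le> (b * (x - c) + N / (2 * b) * (x - c) ^ 3)\<^sup>2"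
      using \<open>b > 0\<close> by simp
    with N(2)[OF x]
    show "(slope v x)\<^sup>2 + \<kappa> * (x - c)\<^sup>2 \<le> (b * (x - c) + N / (2 * b) * (x - c) ^ 3)\<^sup>2" by simp
  qed (use N \<open>b > 0\<close> \<open>\<kappa> > 0\<close> in auto)
qed

text \<open>
  If \<open>1 - H > d b\<close>, the cubic barrier through \<open>c\<close> can only be crossed upwards. A slope that is
  nonnegative at \<open>c\<close> then exceeds \<open>s\<close> during the following period, and a slope that is negative at
  \<open>c\<close> lies below \<open>-s\<close> during the preceding one. Both contradict the mean.
\<close>
lemma energy_lower_bound:
  assumes "v c = 0" "b > 0" "b\<^sup>2 > - v2 c" and small: "\<bar>\<mu>\<bar> < integral {0..1} (slope v)"
  shows "\<forall>\<^sub>F d in at_right 0. \<forall>H W p q. tilted d \<mu> H W p q \<longrightarrow> 1 - H \<le> d * b"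
proof -
  obtain K \<kappa> where K: "K \<ge> 0" "\<kappa> > 0"
    "\<And>x. \<bar>x - c\<bar> \<le> 1 \<Longrightarrow>
       (slope v x)\<^sup>2 + \<kappa> * (x - c)\<^sup>2 \<le> (b * (x - c) + K * (x - c) ^ 3)\<^sup>2"
    using cubic_above_slope[OF assms(1-3)] by metis
  define P where "P = (\<lambda>x. b * (x - c) + K * (x - c) ^ 3)"
  define P1 where "P1 = (\<lambda>x. b + 3 * K * (x - c)\<^sup>2)"
  have P: "(P has_real_derivative P1 x) (at x)" for x
    unfolding P_def P1_def by (auto intro!: derivative_eq_intros simp: power2_eq_square)
  have "continuous_on {c-1..c+1} (\<lambda>x. sqrt (1 + (P x)\<^sup>2) + (1 - v x))"
    unfolding P_def by (intro continuous_intros v_cont)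
  then have "bounded ((\<lambda>x. sqrt (1 + (P x)\<^sup>2) + (1 - v x)) ` {c-1..c+1})"
    by (intro compact_imp_bounded compact_continuous_image) auto
  then obtain M where M: "M > 0" "\<And>x. \<bar>x - c\<bar> \<le> 1 \<Longrightarrow> sqrt (1 + (P x)\<^sup>2) + (1 - v x) \<le> M"
    unfolding bounded_pos by (force simp: abs_le_iff)
  have gap: "sqrt (1 + (P x)\<^sup>2) + v x - 1 \<ge> \<kappa> / M * (x - c)\<^sup>2" if x: "\<bar>x - c\<bar> \<le> 1" for x
  proof -
    let ?u = "sqrt (1 + (P x)\<^sup>2) - (1 - v x)" and ?w = "sqrt (1 + (P x)\<^sup>2) + (1 - v x)"
    have w: "?w > 0" using v_nonpos[of x] by (simp add: add_pos_nonneg)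
    have uw: "\<kappa> * (x - c)\<^sup>2 \<le> ?u * ?w"
      using K(3)[OF x] by (simp add: hamiltonian_gap P_def)
    then have "?u \<ge> 0" using w K(2) by (smt (verit) mult_neg_pos zero_le_mult_iff zero_le_power2)
    then have "?u * ?w \<le> ?u * M" using M(2)[OF x] by (intro mult_left_mono) auto
    with uw have "\<kappa> * (x - c)\<^sup>2 \<le> ?u * M" by simp
    then show ?thesis using M(1) by (simp add: field_simps)
  qed
  have "\<forall>\<^sub>F d in at_right (0::real). d * (3 * K) < \<kappa> / M"
    using K M by (intro eventually_right_mult_less) auto
  moreover have "\<forall>\<^sub>F d in at_right (0::real). d > 0" by (simp add: eventually_at_right_less)
  ultimately show ?thesis
  proof eventually_elim
    case (elim d)
    show ?case
    proof (intro allI impI, rule ccontr)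
      fix H W p q assume T: "tilted d \<mu> H W p q" and "\<not> 1 - H \<le> d * b"
      then have H: "1 - H > d * b" by simp
      have sub: "d * P1 x < (1 + (P x)\<^sup>2) * (sqrt (1 + (P x)\<^sup>2) + v x - H)" if x: "\<bar>x - c\<bar> \<le> 1" for x
      proof -
        have "d * (3 * K) * (x - c)\<^sup>2 \<le> \<kappa> / M * (x - c)\<^sup>2"
          using elim by (intro mult_right_mono) auto
        then have "d * P1 x < 1 * (sqrt (1 + (P x)\<^sup>2) + v x - H)"
          using H gap[OF x] by (simp add: P1_def algebra_simps)
        also have "\<dots> \<le> (1 + (P x)\<^sup>2) * (sqrt (1 + (P x)\<^sup>2) + v x - H)"
        proof (rule mult_right_mono)
          have "0 \<le> d * b" "0 \<le> \<kappa> / M * (x - c)\<^sup>2" using \<open>d > 0\<close> \<open>b > 0\<close> K M by auto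
          then show "0 \<le> sqrt (1 + (P x)\<^sup>2) + v x - H" using gap[OF x] H by linarith
        qed auto
        finally show ?thesis .
      qed
      have P_slope: "slope v x \<le> \<bar>P x\<bar>" if "\<bar>x - c\<bar> \<le> 1" for x
      proof -
        have "(slope v x)\<^sup>2 \<le> (P x)\<^sup>2"
          using K(3)[OF that] K(2) by (smt (verit) P_def mult_nonneg_nonneg zero_le_power2)
        then show ?thesis using slope_nonneg[of x] by (metis abs_le_square_iff abs_of_nonneg)
      qed
      show False
      proof (cases "p c \<ge> 0")
        case True
        obtain x where x: "x \<in> {c<..<c+1}" "p x < slope v x"
          using mean_slope_bound(1)[OF T small] by blast
        have "P x < p x"
        proof (rule barrier_above[OF T \<open>d > 0\<close>, of c x P P1])
          show "P c \<le> p c" using True by (simp add: P_def)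
        qed (use x in \<open>auto intro: P intro!: sub\<close>)
        moreover have "P x \<ge> 0" using x \<open>b > 0\<close> K by (simp add: P_def)
        ultimately show False using P_slope[of x] x by auto
      next
        case False
        obtain x where x: "x \<in> {c-1<..<c-1+1}" "p x > - slope v x"
          using mean_slope_bound(2)[OF T small] by blast
        have "p x < P x"
        proof (rule ccontr)
          assume "\<not> p x < P x"
          then have "P c < p c"
            by (intro barrier_above[OF T \<open>d > 0\<close>, of x c P P1])
              (use x in \<open>auto intro!: P sub\<close>)
          then show False using False by (simp add: P_def)
        qed
        moreover have "P x \<le> 0"
        proof -
          have "(x - c) ^ 3 \<le> 0" using x by (simp add: power3_eq_cube mult_nonneg_nonpos mult_nonpos_nonpos)
          then show ?thesis using x \<open>b > 0\<close> K by (simp add: P_def mult_nonneg_nonpos add_nonpos_nonpos)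
        qed
        ultimately show False using P_slope[of x] x by auto
      qed
    qed
  qed
qed

section \<open>At most one change of sign per period\<close>

text \<open>
  The barrier has to vanish at each zero \<open>z\<close> of \<open>v\<close> with the prescribed slope \<open>\<beta>\<close>, and to stay
  strictly between \<open>-s\<close> and \<open>s\<close> elsewhere. Since \<open>v'\<close> vanishes at the zeros with derivative
  \<open>v'' z\<close>, the first is achieved by \<open>- k v'\<close> with a polynomial \<open>k\<close> interpolating
  \<open>\<beta> / (- v'' z)\<close>, and the second by dividing by \<open>1 + K s\<^sup>2\<close> with a large \<open>K\<close>, which does not change
  the slopes at the zeros. At the zeros the barrier inequality holds because \<open>\<beta> > b\<close>; elsewhere
  \<open>F B + v - 1\<close> is at most a negative multiple of \<open>s\<^sup>2\<close>, which dominates for small \<open>d\<close>.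
\<close>
lemma falling_barrier:
  assumes fin: "finite {z \<in> {l..r}. v z = 0}"
    and sharp: "\<And>z. z \<in> {l..r} \<Longrightarrow> v z = 0 \<Longrightarrow> - v2 z > \<alpha>" and "\<alpha> \<ge> 0"
  shows "\<exists>\<rho> b B B1. 0 \<le> \<rho> \<and> \<rho> < 1 \<and> b > 0 \<and> b\<^sup>2 > \<alpha> \<and>
    (\<forall>x. (B has_real_derivative B1 x) (at x)) \<and>
    (\<forall>x\<in>{l..r}. \<bar>B x\<bar> \<le> \<rho> * slope v x) \<and>
    (\<forall>\<^sub>F d in at_right 0. \<forall>H. 1 - H \<le> d * b \<longrightarrow>
       (\<forall>x\<in>{l..r}. (1 + (B x)\<^sup>2) * (sqrt (1 + (B x)\<^sup>2) + v x - H) < d * B1 x))"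
proof -
  define Z where "Z = {z \<in> {l..r}. v z = 0}"
  obtain m b \<beta> where m: "\<And>z. z \<in> Z \<Longrightarrow> m \<le> - v2 z" and b: "0 < b" "\<alpha> < b\<^sup>2" "b < \<beta>" "\<beta>\<^sup>2 < m"
    using curvature_separation[of Z \<alpha> "\<lambda>z. - v2 z"] fin sharp \<open>\<alpha> \<ge> 0\<close> by (auto simp: Z_def)
  have "m > 0" using b by (smt (verit) zero_le_power2)
  then obtain \<theta> where \<theta>: "\<beta>\<^sup>2 / m < \<theta>" "\<theta> < 1" using b dense[of "\<beta>\<^sup>2 / m" 1] by auto
  have \<theta>m: "\<beta>\<^sup>2 < \<theta> * m" using \<theta> \<open>m > 0\<close> by (simp add: field_simps)
  have "\<theta> > 0" using \<theta>(1) \<open>m > 0\<close> by (smt (verit) divide_nonneg_pos zero_le_power2)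
  obtain k where k: "\<And>z. z \<in> Z \<Longrightarrow> poly k z = \<beta> / - v2 z"
    using polynomial_interpolation[of Z "\<lambda>z. \<beta> / - v2 z"] fin by (auto simp: Z_def)
  define u where "u = (\<lambda>x. poly k x * v1 x)"
  define u1 where "u1 = (\<lambda>x. poly k x * v2 x + poly (pderiv k) x * v1 x)"
  have u: "(u has_real_derivative u1 x) (at x)" for x
    unfolding u_def u1_def by (auto intro!: derivative_eq_intros v1_deriv poly_DERIV)
  define S where "S = (\<lambda>x. (slope v x)\<^sup>2)"
  define S1 where "S1 = (\<lambda>x. - 2 * (1 - v x) * v1 x)"
  have S: "(S has_real_derivative S1 x) (at x)" for x
    unfolding S_def S1_def by (rule slope_sq_deriv)
  have S0: "S x \<ge> 0" "S x = 0 \<longleftrightarrow> v x = 0" for x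
    by (auto simp: S_def slope_zero_iff)
  have cont: "isCont u x" "isCont S x" "isCont v1 x" "isCont v2 x" "isCont v x" for x
    using v2_cont DERIV_isCont[OF u] DERIV_isCont[OF S] DERIV_isCont[OF v1_deriv] DERIV_isCont[OF v_deriv]
    by (auto simp: continuous_on_eq_continuous_at)
  \<comment> \<open>near a zero \<open>u\<^sup>2 / s\<^sup>2\<close> tends to \<open>\<beta>\<^sup>2 / (- v2)\<close>, below \<open>\<theta>\<close>; elsewhere a large \<open>K\<close> does it\<close>
  have "\<exists>K\<ge>0. \<forall>x\<in>{l..r}. (u x)\<^sup>2 \<le> \<theta> * S x * (1 + K * S x)"
  proof (rule compact_local_threshold)
    fix N N' x :: real
    assume "N \<le> N'"
    then have "\<theta> * S x * (1 + N * S x) \<le> \<theta> * S x * (1 + N' * S x)"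
      using S0 \<open>\<theta> > 0\<close> by (intro mult_left_mono add_left_mono mult_right_mono) auto
    then show "(u x)\<^sup>2 \<le> \<theta> * S x * (1 + N * S x) \<Longrightarrow> (u x)\<^sup>2 \<le> \<theta> * S x * (1 + N' * S x)" by simp
  next
    fix x assume x: "x \<in> {l..r}"
    show "\<exists>N. \<forall>\<^sub>F x in nhds x. (u x)\<^sup>2 \<le> \<theta> * S x * (1 + N * S x)"
    proof (cases "v x = 0")
      case True
      then have "x \<in> Z" using x by (simp add: Z_def)
      have curv: "v2 x \<noteq> 0" using m[OF \<open>x \<in> Z\<close>] \<open>m > 0\<close> by auto
      have "((\<lambda>y. (poly k y * (v1 y / (y - x)))\<^sup>2) \<longlongrightarrow> (poly k x * v2 x)\<^sup>2) (at x)"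
        by (intro tendsto_intros slope_at_zero(2)[OF True])
      then have "((\<lambda>y. (poly k y * (v1 y / (y - x)))\<^sup>2) \<longlongrightarrow> \<beta>\<^sup>2) (at x)"
        using curv k[OF \<open>x \<in> Z\<close>] by simp
      moreover have "((\<lambda>y. \<theta> * (S y / (y - x)\<^sup>2)) \<longlongrightarrow> \<theta> * - v2 x) (at x)"
        unfolding S_def by (intro tendsto_intros slope_at_zero(1)[OF True])
      ultimately have "((\<lambda>y. \<theta> * (S y / (y - x)\<^sup>2) - (poly k y * (v1 y / (y - x)))\<^sup>2) \<longlongrightarrow> \<theta> * - v2 x - \<beta>\<^sup>2) (at x)"
        by (rule tendsto_diff[rotated])
      moreover have "\<theta> * - v2 x - \<beta>\<^sup>2 > 0"
        using \<theta>m mult_left_mono[OF m[OF \<open>x \<in> Z\<close>], of \<theta>] \<open>\<theta> > 0\<close> by linarith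
      ultimately have "\<forall>\<^sub>F y in at x. \<theta> * (S y / (y - x)\<^sup>2) - (poly k y * (v1 y / (y - x)))\<^sup>2 > 0"
        by (rule order_tendstoD(1))
      moreover have "\<forall>\<^sub>F y in at x. y \<noteq> x" by (simp add: eventually_at_filter)
      ultimately have "\<forall>\<^sub>F y in at x. (u y)\<^sup>2 \<le> \<theta> * S y * (1 + 0 * S y)"
        by eventually_elim (simp add: u_def field_simps power_mult_distrib)
      then show ?thesis using True zero_critical[OF True]
        by (intro exI[of _ 0]) (simp add: eventually_nhds_conv_at u_def S_def slope_sq)
    next
      case False
      then have "S x > 0" using S0[of x] by (simp add: order_less_le)
      define N where "N = ((u x)\<^sup>2 + 1) / (\<theta> * (S x)\<^sup>2)"
      have "isCont (\<lambda>x. \<theta> * S x * (1 + N * S x) - (u x)\<^sup>2) x"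
        by (intro continuous_intros cont)
      moreover have "\<theta> * S x * (1 + N * S x) = \<theta> * S x + ((u x)\<^sup>2 + 1)"
        using \<open>S x > 0\<close> \<open>\<theta> > 0\<close> by (simp add: N_def field_simps power2_eq_square)
      then have "\<theta> * S x * (1 + N * S x) - (u x)\<^sup>2 > 0"
        using \<open>S x > 0\<close> \<open>\<theta> > 0\<close> by (simp add: add_pos_pos)
      ultimately have "\<forall>\<^sub>F x in nhds x. \<theta> * S x * (1 + N * S x) - (u x)\<^sup>2 > 0"
        by (rule isCont_eventually_pos)
      then show ?thesis by (intro exI[of _ N]) (auto elim: eventually_mono)
    qed
  qed auto
  then obtain K where K: "K \<ge> 0" "\<And>x. x \<in> {l..r} \<Longrightarrow> (u x)\<^sup>2 \<le> \<theta> * S x * (1 + K * S x)" by blast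
  define D where "D = (\<lambda>x. 1 + K * S x)"
  have D: "D x \<ge> 1" for x using K S0 by (simp add: D_def)
  then have D': "D x \<noteq> 0" for x by (metis not_one_le_zero)
  define B where "B = (\<lambda>x. - u x / D x)"
  define B1 where "B1 = (\<lambda>x. (- u1 x * D x - (- u x) * (K * S1 x)) / (D x * D x))"
  have "(D has_real_derivative K * S1 x) (at x)" for x
    unfolding D_def by (auto intro!: derivative_eq_intros S)
  then have B: "(B has_real_derivative B1 x) (at x)" for x
    unfolding B_def B1_def using D' by (intro DERIV_divide DERIV_minus u) auto
  have B_sq: "(B x)\<^sup>2 \<le> \<theta> * S x" if "x \<in> {l..r}" for x
  proof -
    have "(u x)\<^sup>2 \<le> \<theta> * S x * D x" using K(2)[OF that] by (simp add: D_def)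
    also have "\<dots> \<le> \<theta> * S x * (D x)\<^sup>2"
      using D[of x] S0 \<open>\<theta> > 0\<close> by (intro mult_left_mono self_le_power) auto
    finally show ?thesis using D'[of x] by (simp add: B_def power_divide field_simps)
  qed
  have B_le: "\<bar>B x\<bar> \<le> sqrt \<theta> * slope v x" if "x \<in> {l..r}" for x
    using real_sqrt_le_mono[OF B_sq[OF that]] slope_nonneg[of x]
    by (simp add: S_def real_sqrt_mult)
  have contB1: "isCont B1 x" for x
    unfolding B1_def D_def u1_def S1_def using D'[of x]
    by (intro continuous_intros cont) (auto simp: D_def)
  have contB: "isCont B x" for x by (rule DERIV_isCont[OF B])
  have "\<exists>N\<ge>0. \<forall>x\<in>{l..r}. (1 + (B x)\<^sup>2) * b < B1 x + N * S x"
  proof (rule compact_local_threshold)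
    fix N N' x :: real
    assume "N \<le> N'"
    then have "N * S x \<le> N' * S x" using S0 by (intro mult_right_mono)
    then show "(1 + (B x)\<^sup>2) * b < B1 x + N * S x \<Longrightarrow> (1 + (B x)\<^sup>2) * b < B1 x + N' * S x" by simp
  next
    fix x assume x: "x \<in> {l..r}"
    have ex: "\<exists>N. B1 x + N * S x - (1 + (B x)\<^sup>2) * b > 0"
    proof (cases "v x = 0")
      case True
      then have "x \<in> Z" using x by (simp add: Z_def)
      have curv: "v2 x \<noteq> 0" using m[OF \<open>x \<in> Z\<close>] \<open>m > 0\<close> by auto
      have "B1 x = \<beta>" "B x = 0"
        using zero_critical[OF True] S0(2)[of x] True k[OF \<open>x \<in> Z\<close>] curv
        by (simp_all add: B1_def B_def D_def u_def u1_def S1_def)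
      then show ?thesis using b by (auto intro!: exI[of _ 0])
    next
      case False
      then have "S x > 0" using S0[of x] by (simp add: order_less_le)
      then show ?thesis
        by (intro exI[of _ "((1 + (B x)\<^sup>2) * b - B1 x + 1) / S x"]) simp
    qed
    then obtain N where "B1 x + N * S x - (1 + (B x)\<^sup>2) * b > 0" by blast
    moreover have "isCont (\<lambda>x. B1 x + N * S x - (1 + (B x)\<^sup>2) * b) x"
      by (intro continuous_intros cont contB contB1)
    ultimately have "\<forall>\<^sub>F x in nhds x. B1 x + N * S x - (1 + (B x)\<^sup>2) * b > 0"
      by (intro isCont_eventually_pos)
    then show "\<exists>N. \<forall>\<^sub>F x in nhds x. (1 + (B x)\<^sup>2) * b < B1 x + N * S x"
      by (intro exI[of _ N]) (auto elim: eventually_mono)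
  qed auto
  then obtain N where N: "N \<ge> 0" "\<And>x. x \<in> {l..r} \<Longrightarrow> (1 + (B x)\<^sup>2) * b < B1 x + N * S x" by blast
  obtain M where M: "M > 0" "\<And>x. \<bar>1 - v x\<bar> \<le> M"
    by (rule periodic_imp_bounded[of "\<lambda>x. 1 - v x"]) (auto simp: v_periodic intro!: continuous_intros v_cont)
  define c where "c = (1 - \<theta>) / (2 * M)"
  have "c > 0" using \<theta> M by (simp add: c_def)
  have gap: "sqrt (1 + (B x)\<^sup>2) + v x - 1 \<le> - c * S x" if x: "x \<in> {l..r}" for x
  proof -
    let ?s = "sqrt (1 + (B x)\<^sup>2)"
    have sl: "(B x)\<^sup>2 \<le> S x"
      using B_sq[OF x] mult_right_mono[of \<theta> 1 "S x"] \<theta> S0(1)[of x] by linarith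
    then have le: "?s \<le> 1 - v x"
      by (subst slope_eikonal[symmetric]) (simp add: S_def)
    have "(1 - \<theta>) * S x \<le> S x - (B x)\<^sup>2" using B_sq[OF x] by (simp add: algebra_simps)
    also have "\<dots> = ((1 - v x) - ?s) * (?s + (1 - v x))"
      using hamiltonian_gap[of "B x" x] by (simp add: S_def algebra_simps)
    also have "\<dots> \<le> ((1 - v x) - ?s) * (2 * M)"
      using le M(2)[of x] by (intro mult_left_mono) auto
    finally show ?thesis using M(1) by (simp add: c_def field_simps)
  qed
  have "\<forall>\<^sub>F d in at_right (0::real). d * N < c" by (rule eventually_right_mult_less[OF \<open>c > 0\<close>])
  moreover have "\<forall>\<^sub>F d in at_right (0::real). d > 0" by (simp add: eventually_at_right_less)
  ultimately have "\<forall>\<^sub>F d in at_right 0. \<forall>H. 1 - H \<le> d * b \<longrightarrow>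
       (\<forall>x\<in>{l..r}. (1 + (B x)\<^sup>2) * (sqrt (1 + (B x)\<^sup>2) + v x - H) < d * B1 x)"
  proof eventually_elim
    case (elim d)
    show ?case
    proof (intro allI impI ballI)
      fix H x assume H: "1 - H \<le> d * b" and x: "x \<in> {l..r}"
      have "(1 + (B x)\<^sup>2) * (sqrt (1 + (B x)\<^sup>2) + v x - H) \<le> (1 + (B x)\<^sup>2) * (- c * S x + d * b)"
        using gap[OF x] H by (intro mult_left_mono) auto
      also have "\<dots> \<le> - c * S x + d * ((1 + (B x)\<^sup>2) * b)"
        using \<open>c > 0\<close> S0(1)[of x] by (simp add: algebra_simps)
      also have "\<dots> < - c * S x + d * (B1 x + N * S x)"
        using N(2)[OF x] \<open>d > 0\<close> by simp
      also have "\<dots> \<le> d * B1 x"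
        using mult_right_mono[of "d * N" c "S x"] elim S0(1)[of x] by (simp add: algebra_simps)
      finally show "(1 + (B x)\<^sup>2) * (sqrt (1 + (B x)\<^sup>2) + v x - H) < d * B1 x" .
    qed
  qed
  then show ?thesis
    using \<theta> \<open>\<theta> > 0\<close> b B B_le
    by (intro exI[of _ "sqrt \<theta>"] exI[of _ b] exI[of _ B] exI[of _ B1]) auto
qed

text \<open>
  The sharpness hypothesis makes \<open>c\<close> the flattest zero, so the lower bound on \<open>H\<close> obtained at
  \<open>c\<close> is exactly what the falling barrier needs at the other zeros. The point \<open>t\<close> is the last
  one at which \<open>p\<close> is above the barrier.
\<close>
lemma single_sign_change:
  assumes c: "v c = 0" and fin: "finite {z \<in> {c<..<c+1}. v z = 0}"
    and sharp: "\<And>z. z \<in> {c<..<c+1} \<Longrightarrow> v z = 0 \<Longrightarrow> - v2 z > - v2 c"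
    and \<delta>: "0 < \<delta>" "\<delta> < 1/2"
    and small: "\<bar>\<mu>\<bar> < integral {0..1} (slope v)"
  obtains \<rho> where "0 \<le> \<rho>" "\<rho> < 1"
    "\<forall>\<^sub>F d in at_right 0. \<forall>H W p q. tilted d \<mu> H W p q \<longrightarrow>
      (\<exists>t\<in>{c+\<delta>..c+1-\<delta>}. (\<forall>x\<in>{c+\<delta>..<t}. - \<rho> * slope v x \<le> p x) \<and>
         (\<forall>x\<in>{t<..c+1-\<delta>}. p x \<le> \<rho> * slope v x))"
proof -
  have inner: "finite {z \<in> {c+\<delta>..c+1-\<delta>}. v z = 0}"
    by (rule finite_subset[OF _ fin]) (use \<delta> in auto)
  have inner_sharp: "- v2 z > - v2 c" if "z \<in> {c+\<delta>..c+1-\<delta>}" "v z = 0" for z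
    using sharp[of z] that \<delta> by auto
  have "- v2 c \<ge> 0" using slope_at_zero(3)[OF c] by simp
  obtain B B1 \<rho> b where \<rho>: "0 \<le> \<rho>" "\<rho> < 1" and b: "b > 0" "b\<^sup>2 > - v2 c"
    and B: "\<And>x. (B has_real_derivative B1 x) (at x)"
      "\<And>x. x \<in> {c+\<delta>..c+1-\<delta>} \<Longrightarrow> \<bar>B x\<bar> \<le> \<rho> * slope v x"
    and ev: "\<forall>\<^sub>F d in at_right 0. \<forall>H. 1 - H \<le> d * b \<longrightarrow>
       (\<forall>x\<in>{c+\<delta>..c+1-\<delta>}. (1 + (B x)\<^sup>2) * (sqrt (1 + (B x)\<^sup>2) + v x - H) < d * B1 x)"
    using falling_barrier[OF inner inner_sharp \<open>- v2 c \<ge> 0\<close>] by blast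
  have "\<forall>\<^sub>F d in at_right (0::real). d > 0" by (simp add: eventually_at_right_less)
  with ev energy_lower_bound[OF c b small]
  have "\<forall>\<^sub>F d in at_right 0. \<forall>H W p q. tilted d \<mu> H W p q \<longrightarrow>
      (\<exists>t\<in>{c+\<delta>..c+1-\<delta>}. (\<forall>x\<in>{c+\<delta>..<t}. - \<rho> * slope v x \<le> p x) \<and>
         (\<forall>x\<in>{t<..c+1-\<delta>}. p x \<le> \<rho> * slope v x))"
  proof eventually_elim
    case (elim d)
    show ?case
    proof (intro allI impI)
      fix H W p q assume T: "tilted d \<mu> H W p q"
      have super: "(1 + (B x)\<^sup>2) * (sqrt (1 + (B x)\<^sup>2) + v x - H) < d * B1 x"
        if "x \<in> {c+\<delta>..c+1-\<delta>}" for x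
        using elim T that by blast
      define Z where "Z = insert (c+\<delta>) {x \<in> {c+\<delta>..c+1-\<delta>}. B x \<le> p x}"
      have bdd: "bdd_above Z" by (rule bdd_aboveI[of _ "c+1-\<delta>"]) (use \<delta> in \<open>auto simp: Z_def\<close>)
      have "Z \<noteq> {}" by (simp add: Z_def)
      define t where "t = Sup Z"
      have t: "t \<in> {c+\<delta>..c+1-\<delta>}"
        unfolding t_def using \<delta> bdd
        by (auto intro!: cSup_upper cSup_least simp: Z_def)
      have before: "- \<rho> * slope v x \<le> p x" if x: "x \<in> {c+\<delta>..<t}" for x
      proof -
        obtain y where y: "y \<in> Z" "x < y"
          using x less_cSup_iff[OF \<open>Z \<noteq> {}\<close> bdd] by (auto simp: t_def)
        then have y': "y \<in> {c+\<delta>..c+1-\<delta>}" "B y \<le> p y" using x by (auto simp: Z_def)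
        have "B x < p x"
        proof (rule ccontr)
          assume "\<not> B x < p x"
          then have "p y < B y"
            by (intro barrier_below[OF T \<open>d > 0\<close> \<open>x < y\<close> _ B(1) super]) (use x y' in auto)
          then show False using y' by simp
        qed
        then show ?thesis using B(2)[of x] x t by auto
      qed
      have after: "p x \<le> \<rho> * slope v x" if x: "x \<in> {t<..c+1-\<delta>}" for x
      proof -
        have "x \<notin> Z" using cSup_upper[OF _ bdd, of x] x by (auto simp: t_def)
        then have "p x < B x" using x t by (auto simp: Z_def)
        then show ?thesis using B(2)[of x] x t by auto
      qed
      show "\<exists>t\<in>{c+\<delta>..c+1-\<delta>}. (\<forall>x\<in>{c+\<delta>..<t}. - \<rho> * slope v x \<le> p x) \<and>
         (\<forall>x\<in>{t<..c+1-\<delta>}. p x \<le> \<rho> * slope v x)"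
        using t before after by blast
    qed
  qed
  then show ?thesis using that \<rho> by blast
qed

section \<open>Convergence in mean to a tent\<close>

text \<open>
  The function \<open>e = F s - F p + \<eta>\<close> is nonnegative by \<open>slope_confinement\<close> and has the explicit
  primitive \<open>(1 - H + \<eta>) x - d arctan p\<close>, so its integral over a period is at most \<open>2 \<eta>\<close>. It
  controls \<open>\<bar>s\<^sup>2 - p\<^sup>2\<bar>\<close>, and by \<open>slope_defect\<close> and the sign information also
  \<open>(p - s)\<^sup>2\<close> before \<open>t\<close> and \<open>(p + s)\<^sup>2\<close> after it. The inequality of arithmetic and geometric means
  turns the squares into first powers at the price of \<open>\<epsilon>\<close>. Near the endpoints of the period,
  where there is no sign information, the crude bound \<open>2 M\<close> on two intervals of length \<open>\<delta>\<close>
  suffices.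
\<close>
lemma solution_close_to_tent:
  assumes c: "v c = 0" and fin: "finite {z \<in> {c<..<c+1}. v z = 0}"
    and sharp: "\<And>z. z \<in> {c<..<c+1} \<Longrightarrow> v z = 0 \<Longrightarrow> - v2 z > - v2 c"
    and small: "\<bar>\<mu>\<bar> < integral {0..1} (slope v)"
    and A: "\<And>x. (A has_real_derivative slope v x) (at x)" "A c = 0"
    and "\<epsilon> > 0"
  shows "\<forall>\<^sub>F d in at_right 0. \<forall>H W p q. tilted d \<mu> H W p q \<longrightarrow>
    (\<exists>t\<in>{c..c+1}. \<forall>x\<in>{c..c+1}. \<bar>W x - W c - (2 * A (min x t) - A x)\<bar> \<le> 3 * \<epsilon>)"
proof -
  obtain M where M: "M > 0" "\<And>x. \<bar>sqrt ((slope v x)\<^sup>2 + 2)\<bar> \<le> M"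
    by (rule periodic_imp_bounded[of "\<lambda>x. sqrt ((slope v x)\<^sup>2 + 2)"])
      (auto simp: slope_periodic intro!: continuous_intros slope_cont)
  define \<delta> where "\<delta> = min (1/4) (\<epsilon> / (4 * M))"
  have \<delta>: "0 < \<delta>" "\<delta> < 1/2" "4 * M * \<delta> \<le> \<epsilon>"
    using M \<open>\<epsilon> > 0\<close> by (auto simp: \<delta>_def min_def field_simps)
  obtain \<rho> where \<rho>: "0 \<le> \<rho>" "\<rho> < 1" and switch:
    "\<forall>\<^sub>F d in at_right 0. \<forall>H W p q. tilted d \<mu> H W p q \<longrightarrow>
      (\<exists>t\<in>{c+\<delta>..c+1-\<delta>}. (\<forall>x\<in>{c+\<delta>..<t}. - \<rho> * slope v x \<le> p x) \<and>
         (\<forall>x\<in>{t<..c+1-\<delta>}. p x \<le> \<rho> * slope v x))"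
    using single_sign_change[OF c fin sharp \<delta>(1,2) small] by blast
  define C where "C = 2 / (1 - \<rho>)"
  have "C > 0" using \<rho> by (simp add: C_def)
  define \<eta> where "\<eta> = min 1 (2 * \<epsilon>\<^sup>2 / (C * (1 + 2 * M)))"
  have CM: "C * (1 + 2 * M) > 0" using \<open>C > 0\<close> M by (simp add: add_pos_pos)
  have \<eta>: "0 < \<eta>" "\<eta> \<le> 1" using CM \<open>\<epsilon> > 0\<close> by (auto simp: \<eta>_def)
  have "\<eta> \<le> 2 * \<epsilon>\<^sup>2 / (C * (1 + 2 * M))" by (simp add: \<eta>_def)
  then have "\<eta> * (C * (1 + 2 * M)) \<le> 2 * \<epsilon>\<^sup>2" using CM by (simp add: pos_le_divide_eq)
  then have budget: "C * \<eta> / (2 * \<epsilon>) + C * M / (2 * \<epsilon>) * (2 * \<eta>) \<le> \<epsilon>"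
    using \<open>\<epsilon> > 0\<close> by (simp add: field_simps power2_eq_square)
  define b where "b = sqrt (- v2 c) + 1"
  have root: "sqrt (- v2 c) \<ge> 0" "(sqrt (- v2 c))\<^sup>2 = - v2 c" using slope_at_zero(3)[OF c] by auto
  have "b > 0" using root(1) unfolding b_def by linarith
  moreover have "b\<^sup>2 = (sqrt (- v2 c))\<^sup>2 + 2 * sqrt (- v2 c) + 1"
    unfolding b_def by (simp add: power2_sum)
  then have "b\<^sup>2 > - v2 c" using root by linarith
  ultimately have b: "b > 0" "b\<^sup>2 > - v2 c" by auto
  have "\<forall>\<^sub>F d in at_right 0. d * b < \<eta>" by (rule eventually_right_mult_less[OF \<eta>(1)])
  moreover have "\<forall>\<^sub>F d in at_right (0::real). d > 0" by (simp add: eventually_at_right_less)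
  ultimately show ?thesis
    using switch slope_confinement[OF \<eta>(1) small] energy_lower_bound[OF c b small]
  proof eventually_elim
    case (elim d)
    show ?case
    proof (intro allI impI)
      fix H W p q assume T: "tilted d \<mu> H W p q"
      obtain t where t: "t \<in> {c+\<delta>..c+1-\<delta>}"
        and before: "\<And>x. x \<in> {c+\<delta>..<t} \<Longrightarrow> - \<rho> * slope v x \<le> p x"
        and after: "\<And>x. x \<in> {t<..c+1-\<delta>} \<Longrightarrow> p x \<le> \<rho> * slope v x"
        using elim(3) T by blast
      have conf: "(p x)\<^sup>2 \<le> (slope v x)\<^sup>2 + \<eta>" for x using elim(4) T by blast
      have H: "1 - H \<le> \<eta>" using elim(1,5) T by fastforce
      have ps: "\<bar>p x\<bar> \<le> M" "slope v x \<le> M" "sqrt (1 + (p x)\<^sup>2) + (1 - v x) \<le> 2 * M" for x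
      proof -
        have *: "sqrt y \<le> M" if "y \<le> (slope v x)\<^sup>2 + 2" for y
          using M(2)[of x] real_sqrt_le_mono[OF that] by linarith
        show "\<bar>p x\<bar> \<le> M" using *[of "(p x)\<^sup>2"] conf[of x] \<eta> by simp
        show "slope v x \<le> M" using *[of "(slope v x)\<^sup>2"] slope_nonneg[of x] by simp
        have "sqrt (1 + (p x)\<^sup>2) \<le> M" by (rule *) (use conf[of x] \<eta> in simp)
        moreover have "1 - v x \<le> M" using *[of "1 + (slope v x)\<^sup>2"] by (simp add: slope_eikonal)
        ultimately show "sqrt (1 + (p x)\<^sup>2) + (1 - v x) \<le> 2 * M" by simp
      qed
      define e where "e = (\<lambda>x. (1 - v x) - sqrt (1 + (p x)\<^sup>2) + \<eta>)"
      have e_nonneg: "e x \<ge> 0" for x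
      proof -
        have "1 + (p x)\<^sup>2 \<le> (1 - v x)\<^sup>2 + \<eta>" using conf[of x] by (simp add: slope_sq)
        then have "sqrt (1 + (p x)\<^sup>2) \<le> sqrt ((1 - v x)\<^sup>2 + \<eta>)" by simp
        also have "\<dots> \<le> 1 - v x + \<eta> / 2"
          by (rule sqrt_excess) (use \<eta> v_nonpos[of x] in auto)
        finally show ?thesis using \<eta> by (simp add: e_def)
      qed
      have defect: "(slope v x)\<^sup>2 - (p x)\<^sup>2 \<le> 2 * M * e x" for x
      proof -
        let ?s = "sqrt (1 + (p x)\<^sup>2)"
        have pos: "?s + (1 - v x) \<ge> 0" using v_nonpos[of x] by simp
        have "(slope v x)\<^sup>2 - (p x)\<^sup>2 = (e x - \<eta>) * (?s + (1 - v x))"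
          using hamiltonian_gap[of "p x" x] by (simp add: e_def algebra_simps)
        also have "\<dots> \<le> e x * (?s + (1 - v x))" using pos \<eta> by (intro mult_right_mono) auto
        also have "\<dots> \<le> e x * (2 * M)" using ps(3)[of x] e_nonneg by (intro mult_left_mono)
        finally show ?thesis by (simp add: algebra_simps)
      qed
      define a where "a = \<epsilon> + C * \<eta> / (2 * \<epsilon>)"
      define g where "g = C * M / (2 * \<epsilon>)"
      have ag: "a \<ge> 0" "g \<ge> 0" using \<open>C > 0\<close> M \<eta> \<open>\<epsilon> > 0\<close> by (auto simp: a_def g_def)
      have near: "\<bar>r - slope v x\<bar> \<le> a + g * e x"
        if "- \<rho> * slope v x \<le> r" "r\<^sup>2 = (p x)\<^sup>2" for r x
      proof -
        let ?z = "\<bar>r - slope v x\<bar>"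
        have "0 \<le> (?z - 2 * \<epsilon>)\<^sup>2" by simp
        then have "4 * \<epsilon> * ?z \<le> 4 * \<epsilon>\<^sup>2 + ?z\<^sup>2" by (simp add: power2_eq_square algebra_simps)
        also have "?z\<^sup>2 \<le> C * ((slope v x)\<^sup>2 - r\<^sup>2 + 2 * \<eta>)"
          using slope_defect[OF \<rho> slope_nonneg _ _ that(1), of \<eta>] conf[of x] that(2) \<eta>(1) by (simp add: C_def)
        also have "\<dots> \<le> C * (2 * M * e x + 2 * \<eta>)"
          using defect[of x] \<open>C > 0\<close> that(2) by simp
        finally show ?thesis using \<open>\<epsilon> > 0\<close>
          by (simp add: a_def g_def field_simps power2_eq_square)
      qed
      define \<Phi> where "\<Phi> = (\<lambda>x. a * x + g * ((1 - H + \<eta>) * x - d * arctan (p x)))"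
      have \<Phi>: "(\<Phi> has_real_derivative a + g * e x) (at x)" for x
      proof -
        have "(\<Phi> has_real_derivative a + g * ((1 - H + \<eta>) - d * (q x / (1 + (p x)\<^sup>2)))) (at x)"
          unfolding \<Phi>_def
          by (auto intro!: derivative_eq_intros tiltedD(3)[OF T] simp: field_simps)
        moreover have "d * (q x / (1 + (p x)\<^sup>2)) = sqrt (1 + (p x)\<^sup>2) + v x - H"
        proof -
          have "1 + (p x)\<^sup>2 \<noteq> 0" by (smt (verit) zero_le_power2)
          then show ?thesis using tiltedD(4)[OF T, of x] by (simp add: field_simps)
        qed
        then have "(1 - H + \<eta>) - d * (q x / (1 + (p x)\<^sup>2)) = e x" by (simp add: e_def)
        ultimately show ?thesis by (simp only:)
      qed
      note W = tiltedD(2)[OF T]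
      \<comment> \<open>the tent with top at \<open>t\<close> is \<open>2 A (min x t) - A x\<close>: slope \<open>s\<close> before \<open>t\<close> and \<open>-s\<close> after it\<close>
      define X where "X = (\<lambda>x. W x - (2 * A (min x t) - A x))"
      \<comment> \<open>\<open>\<Phi>\<close> dominates where the sign is known; the added term grows at rate \<open>2 M\<close> on the two end intervals only\<close>
      define \<Psi> where "\<Psi> = (\<lambda>x. \<Phi> x + 2 * M * (min x (c+\<delta>) + max x (c+1-\<delta>)))"
      define dom where "dom = (\<lambda>l r. \<forall>x y. l \<le> x \<longrightarrow> x \<le> y \<longrightarrow> y \<le> r \<longrightarrow> \<bar>X y - X x\<bar> \<le> \<Psi> y - \<Psi> x)"
      have concat: "dom l r" if "dom l m" "dom m r" "l \<le> m" "m \<le> r" for l m r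
        unfolding dom_def
      proof (intro allI impI)
        fix x y assume xy: "l \<le> x" "x \<le> y" "y \<le> r"
        show "\<bar>X y - X x\<bar> \<le> \<Psi> y - \<Psi> x"
        proof (cases "x \<le> m \<and> m \<le> y")
          case True
          then have "\<bar>X m - X x\<bar> \<le> \<Psi> m - \<Psi> x" "\<bar>X y - X m\<bar> \<le> \<Psi> y - \<Psi> m"
            using that xy unfolding dom_def by auto
          then show ?thesis by linarith
        next
          case False
          then show ?thesis using that xy unfolding dom_def by (meson le_cases order_trans)
        qed
      qed
      have \<Phi>M: "((\<lambda>x. \<Phi> x + 2 * M * x) has_real_derivative a + g * e x + 2 * M) (at x)" for x
        by (auto intro!: derivative_eq_intros \<Phi>)
      have WA: "((\<lambda>x. W x - A x) has_real_derivative p x - slope v x) (at x)"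
        "((\<lambda>x. W x + A x) has_real_derivative p x + slope v x) (at x)" for x
        by (intro DERIV_diff DERIV_add W A)+
      have crude: "\<bar>p x - slope v x\<bar> \<le> a + g * e x + 2 * M"
        "\<bar>p x + slope v x\<bar> \<le> a + g * e x + 2 * M" for x
      proof -
        have "0 \<le> g * e x" using ag e_nonneg by simp
        then show "\<bar>p x - slope v x\<bar> \<le> a + g * e x + 2 * M"
          "\<bar>p x + slope v x\<bar> \<le> a + g * e x + 2 * M"
          using ps(1,2)[of x] slope_nonneg[of x] ag by auto
      qed
      have d1: "dom c (c+\<delta>)"
        unfolding dom_def
      proof (intro allI impI)
        fix x y assume xy: "c \<le> x" "x \<le> y" "y \<le> c+\<delta>"
        have "\<bar>(W y - A y) - (W x - A x)\<bar> \<le> (\<Phi> y + 2 * M * y) - (\<Phi> x + 2 * M * x)"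
          by (rule increments_dominated[OF xy(2) WA(1) \<Phi>M crude(1)])
        then show "\<bar>X y - X x\<bar> \<le> \<Psi> y - \<Psi> x" using xy t \<delta>(2)
          by (simp add: X_def \<Psi>_def min_absorb1 max_absorb2 algebra_simps)
      qed
      have d2: "dom (c+\<delta>) t"
        unfolding dom_def
      proof (intro allI impI)
        fix x y assume xy: "c+\<delta> \<le> x" "x \<le> y" "y \<le> t"
        have "\<bar>(W y - A y) - (W x - A x)\<bar> \<le> \<Phi> y - \<Phi> x"
          by (rule increments_dominated[OF xy(2) WA(1) \<Phi> near[OF before]]) (use xy in auto)
        then show "\<bar>X y - X x\<bar> \<le> \<Psi> y - \<Psi> x" using xy t \<delta>(2)
          by (simp add: X_def \<Psi>_def min_absorb1 min_absorb2 max_absorb2 algebra_simps)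
      qed
      have d3: "dom t (c+1-\<delta>)"
        unfolding dom_def
      proof (intro allI impI)
        fix x y assume xy: "t \<le> x" "x \<le> y" "y \<le> c+1-\<delta>"
        have "\<bar>(W y + A y) - (W x + A x)\<bar> \<le> \<Phi> y - \<Phi> x"
        proof (rule increments_dominated[OF xy(2) WA(2) \<Phi>])
          fix z assume "x < z" "z < y"
          then have "- \<rho> * slope v z \<le> - p z" using after[of z] xy by auto
          from near[OF this] show "\<bar>p z + slope v z\<bar> \<le> a + g * e z" by (auto simp: abs_le_iff)
        qed
        then show "\<bar>X y - X x\<bar> \<le> \<Psi> y - \<Psi> x" using xy t \<delta>(2)
          by (simp add: X_def \<Psi>_def min_absorb1 min_absorb2 max_absorb2 algebra_simps)
      qed
      have d4: "dom (c+1-\<delta>) (c+1)"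
        unfolding dom_def
      proof (intro allI impI)
        fix x y assume xy: "c+1-\<delta> \<le> x" "x \<le> y" "y \<le> c+1"
        have "\<bar>(W y + A y) - (W x + A x)\<bar> \<le> (\<Phi> y + 2 * M * y) - (\<Phi> x + 2 * M * x)"
          by (rule increments_dominated[OF xy(2) WA(2) \<Phi>M crude(2)])
        then show "\<bar>X y - X x\<bar> \<le> \<Psi> y - \<Psi> x" using xy t \<delta>(2)
          by (simp add: X_def \<Psi>_def min_absorb2 max_absorb1 algebra_simps)
      qed
      have whole: "dom c (c+1)"
        using t \<delta> by (intro concat[OF concat[OF concat[OF d1 d2] d3] d4]) auto
      have total: "\<Psi> (c+1) - \<Psi> c \<le> 3 * \<epsilon>"
      proof -
        have per: "p (1 + c) = p c" using tiltedD(5)[OF T, of c] by (simp add: add.commute)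
        have "\<Psi> (c+1) - \<Psi> c = a + g * (1 - H + \<eta>) + 4 * M * \<delta>"
          using \<delta> by (simp add: \<Psi>_def \<Phi>_def per algebra_simps)
        also have "\<dots> \<le> a + g * (2 * \<eta>) + \<epsilon>"
          using H ag \<delta>(3) by (intro add_mono mult_left_mono) auto
        finally show ?thesis using budget by (simp add: a_def g_def)
      qed
      have "\<bar>W x - W c - (2 * A (min x t) - A x)\<bar> \<le> 3 * \<epsilon>" if x: "x \<in> {c..c+1}" for x
      proof -
        have "\<bar>X x - X c\<bar> \<le> \<Psi> x - \<Psi> c" "\<bar>X (c+1) - X x\<bar> \<le> \<Psi> (c+1) - \<Psi> x"
          using whole x unfolding dom_def by auto
        moreover have "X c = W c" using t \<delta> A(2) by (simp add: X_def min_absorb1)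
        ultimately show ?thesis using total by (simp add: X_def)
      qed
      then show "\<exists>t\<in>{c..c+1}. \<forall>x\<in>{c..c+1}. \<bar>W x - W c - (2 * A (min x t) - A x)\<bar> \<le> 3 * \<epsilon>"
        using t \<delta> by (intro bexI[of _ t]) auto
    qed
  qed
qed

end

section \<open>The vanishing viscosity limit\<close>

lemma one_periodic_shift:
  assumes "one_periodic f"
  obtains y where "y \<in> {c..c+1}" "f x = f y"
proof -
  interpret periodic_fun_simple' f by standard (use assms in \<open>simp add: one_periodic_def\<close>)
  have "f x = f (c + frac (x - c))"
    using plus_of_int[of "c + frac (x - c)" "\<lfloor>x - c\<rfloor>"] by (simp add: frac_def)
  then show ?thesis using that[of "c + frac (x - c)"] frac_lt_1[of "x - c"] by auto
qed

lemma zero_points_frac: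
  assumes "one_periodic v" "v z = 0"
  shows "frac z \<in> zero_points v"
proof -
  interpret periodic_fun_simple' v by standard (use assms in \<open>simp add: one_periodic_def\<close>)
  have "v z = v (frac z)" using plus_of_int[of "frac z" "\<lfloor>z\<rfloor>"] by (simp add: frac_def)
  then show ?thesis using assms frac_lt_1[of z] by (simp add: zero_points_def)
qed

lemma cell_solution_imp_tilted:
  assumes "potential v v1 v2" "cell_solution v d \<mu> H w" 
  shows "potential.tilted v d \<mu> H (\<lambda>x. w x + \<mu> * x) (\<lambda>x. \<mu> + deriv w x) (deriv (deriv w))"
proof -
  have w: "(w has_real_derivative deriv w x) (at x)"
    "(deriv w has_real_derivative deriv (deriv w) x) (at x)" "w (x + 1) = w x" for x
    using assms by (auto simp: cell_solution_def C2_def one_periodic_def DERIV_deriv_iff_real_differentiable)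
  have ode: "d * deriv (deriv w) x =
      (1 + (\<mu> + deriv w x)\<^sup>2) * (sqrt (1 + (\<mu> + deriv w x)\<^sup>2) + v x - H)" for x
  proof -
    have "1 + (\<mu> + deriv w x)\<^sup>2 \<noteq> 0" by (smt (verit) zero_le_power2)
    moreover have "- (d * deriv (deriv w) x) / (1 + (\<mu> + deriv w x)\<^sup>2)
          + sqrt (1 + (\<mu> + deriv w x)\<^sup>2) + v x = H"
      using assms by (simp add: cell_solution_def)
    ultimately show ?thesis by (simp add: field_simps)
  qed
  show ?thesis
    unfolding potential.tilted_def[OF assms(1)]
    by (intro conjI allI ode) (auto intro!: derivative_eq_intros w simp: w algebra_simps)
qed

theorem theorem1p2:
  fixes v :: "real \<Rightarrow> real" and \<mu> xbar x\<mu> :: real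
    and w :: "real \<Rightarrow> real \<Rightarrow> real" and w\<^sub>0 :: "real \<Rightarrow> real"
  assumes v_smooth: "smooth v" and v_periodic: "one_periodic v"
    and v_max: "\<forall>x. v x \<le> 0" "\<exists>x. v x = 0"
    and M0_finite: "finite (zero_points v)"
    and M0_distinct: "inj_on (deriv (deriv v)) (zero_points v)"
    and mu_bound: "\<bar>\<mu>\<bar> < integral {0..1} (slope v)"
    and xbar_in: "xbar \<in> zero_points v"
    and xbar_min: "- deriv (deriv v) xbar = Min ((\<lambda>x. - deriv (deriv v) x) ` zero_points v)"
    and xmu_in: "x\<mu> \<in> {xbar<..<xbar + 1}"
    and xmu_eq: "integral {xbar..x\<mu>} (slope v) - integral {x\<mu>..xbar + 1} (slope v) = \<mu>"
    and w_sol: "\<And>d. d > 0 \<Longrightarrow> cell_solution v d \<mu> (effective_H v d \<mu>) (w d)"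
    and w_norm: "\<And>d. d > 0 \<Longrightarrow> w d 0 = 0"
    and w0_periodic: "one_periodic w\<^sub>0"
    and w0_left: "\<And>x. x \<in> {xbar..x\<mu>} \<Longrightarrow>
      w\<^sub>0 x = integral {xbar..x} (slope v) - \<mu> * x"
    and w0_right: "\<And>x. x \<in> {x\<mu>..xbar + 1} \<Longrightarrow>
      w\<^sub>0 x = integral {xbar..x\<mu>} (slope v) - integral {x\<mu>..x} (slope v) - \<mu> * x"
  shows "uniform_limit UNIV w (\<lambda>x. w\<^sub>0 x - w\<^sub>0 0) (at_right 0)"
proof -
  let ?v2 = "deriv (deriv v)"
  have diff: "(deriv ^^ n) v differentiable (at x)" for n x
    using v_smooth by (simp add: smooth_def)
  have pot: "potential v (deriv v) ?v2"
  proof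
    show "(v has_real_derivative deriv v x) (at x)" for x
      using diff[of 0 x] by (simp add: DERIV_deriv_iff_real_differentiable)
    show "(deriv v has_real_derivative ?v2 x) (at x)" for x
      using diff[of 1 x] by (simp add: DERIV_deriv_iff_real_differentiable)
    show "continuous_on UNIV ?v2"
      using diff[of 2] by (auto simp: numeral_2_eq_2 continuous_on_eq_continuous_at
          intro: differentiable_imp_continuous_within)
  qed (use v_periodic v_max in \<open>auto simp: one_periodic_def\<close>)
  interpret potential v "deriv v" ?v2 by (fact pot)
  have c: "v xbar = 0" "xbar \<in> {0..<1}" using xbar_in by (auto simp: zero_points_def)
  have frac_zero: "frac z \<in> zero_points v" if "v z = 0" for z
    by (rule zero_points_frac[OF assms(2) that])
  have "z \<in> zero_points v \<union> (\<lambda>x. x + 1) ` zero_points v" if "z \<in> {xbar<..<xbar+1}" "v z = 0" for z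
  proof -
    have "\<lfloor>z\<rfloor> = 0 \<or> \<lfloor>z\<rfloor> = 1" using that c by (auto simp: floor_eq_iff)
    then have "z = frac z \<or> z = frac z + 1" by (auto simp: frac_def)
    then show ?thesis using frac_zero[OF that(2)] by (metis UnI1 UnI2 image_eqI)
  qed
  then have "{z \<in> {xbar<..<xbar+1}. v z = 0} \<subseteq> zero_points v \<union> (\<lambda>x. x + 1) ` zero_points v"
    by blast
  then have fin: "finite {z \<in> {xbar<..<xbar+1}. v z = 0}"
    by (rule finite_subset) (intro finite_UnI finite_imageI M0_finite)
  have sharp: "- ?v2 z > - ?v2 xbar" if z: "z \<in> {xbar<..<xbar+1}" "v z = 0" for z
  proof -
    interpret v2: periodic_fun_simple' ?v2 by standard (rule v2_periodic)
    have "?v2 z = ?v2 (frac z)" using v2.plus_of_int[of "frac z" "\<lfloor>z\<rfloor>"] by (simp add: frac_def)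
    moreover have "frac z \<noteq> xbar"
    proof
      assume "frac z = xbar"
      then have eq: "z = xbar + of_int \<lfloor>z\<rfloor>" by (simp add: frac_def)
      have "0 < real_of_int \<lfloor>z\<rfloor>" "real_of_int \<lfloor>z\<rfloor> < 1"
        using eq z(1) unfolding greaterThanLessThan_iff by linarith+
      then show False by simp
    qed
    then have "?v2 (frac z) \<noteq> ?v2 xbar"
      using M0_distinct frac_zero[OF z(2)] xbar_in by (auto dest: inj_onD)
    moreover have "- ?v2 xbar \<le> - ?v2 (frac z)"
      unfolding xbar_min using frac_zero[OF z(2)] M0_finite by (intro Min_le) auto
    ultimately show ?thesis by simp
  qed
  obtain A where A: "\<And>x. (A has_real_derivative slope v x) (at x)" "A xbar = 0"
    "\<And>a b. a \<le> b \<Longrightarrow> integral {a..b} (slope v) = A b - A a"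
    using slope_primitive by metis
  have A_mono: "A x \<le> A y" if "x \<le> y" for x y
    by (rule DERIV_nonneg_imp_nondecreasing[OF that]) (use A(1) slope_nonneg in blast)
  have \<mu>: "\<mu> = 2 * A x\<mu> - A (xbar + 1)"
    using xmu_eq xmu_in A(2,3) by simp
  have w0: "w\<^sub>0 x = 2 * A (min x x\<mu>) - A x - \<mu> * x" if "x \<in> {xbar..xbar+1}" for x
  proof (cases "x \<le> x\<mu>")
    case True
    then show ?thesis using w0_left[of x] that A(2,3) by simp
  next
    case False
    then show ?thesis using w0_right[of x] that xmu_in A(2,3) by simp
  qed
  show ?thesis
    unfolding uniform_limit_iff
  proof (intro allI impI)
    fix \<epsilon> :: real assume "\<epsilon> > 0"
    then have "\<epsilon> / 15 > 0" by simp
    from solution_close_to_tent[OF c(1) fin sharp mu_bound A(1,2) this]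
    have "\<forall>\<^sub>F d in at_right 0. \<forall>H W p q. tilted d \<mu> H W p q \<longrightarrow>
      (\<exists>t\<in>{xbar..xbar+1}. \<forall>x\<in>{xbar..xbar+1}.
         \<bar>W x - W xbar - (2 * A (min x t) - A x)\<bar> \<le> \<epsilon> / 5)"
      by simp
    moreover have "\<forall>\<^sub>F d in at_right (0::real). d > 0" by (simp add: eventually_at_right_less)
    ultimately show "\<forall>\<^sub>F d in at_right 0. \<forall>x\<in>UNIV. dist (w d x) (w\<^sub>0 x - w\<^sub>0 0) < \<epsilon>"
    proof eventually_elim
      case (elim d)
      define W where "W = (\<lambda>x. w d x + \<mu> * x)"
      have T: "tilted d \<mu> (effective_H v d \<mu>) W (\<lambda>x. \<mu> + deriv (w d) x) (deriv (deriv (w d)))"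
        unfolding W_def by (rule cell_solution_imp_tilted[OF pot w_sol[OF \<open>d > 0\<close>]])
      obtain t where t: "\<And>x. x \<in> {xbar..xbar+1} \<Longrightarrow>
          \<bar>W x - W xbar - (2 * A (min x t) - A x)\<bar> \<le> \<epsilon> / 5" and "t \<in> {xbar..xbar+1}"
        using elim(1) T by blast
      \<comment> \<open>at \<open>xbar + 1\<close> both tents have gained \<open>\<mu>\<close> up to \<open>\<epsilon> / 5\<close>, so their tops have nearly the same height\<close>
      have "\<bar>2 * A x\<mu> - 2 * A t\<bar> \<le> \<epsilon> / 5"
        using t[of "xbar + 1"] \<mu> tiltedD(1)[OF T, of xbar] \<open>t \<in> {xbar..xbar+1}\<close>
        by (simp add: min_absorb2)
      moreover have "\<bar>A (min x x\<mu>) - A (min x t)\<bar> \<le> \<bar>A x\<mu> - A t\<bar>" for x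
        using A_mono[of x x\<mu>] A_mono[of x t] A_mono[of t x] A_mono[of x\<mu> x]
          A_mono[of x\<mu> t] A_mono[of t x\<mu>]
        by (auto simp: min_def)
      ultimately have near: "\<bar>w d x - w\<^sub>0 x - W xbar\<bar> \<le> 2 * \<epsilon> / 5" if "x \<in> {xbar..xbar+1}" for x
        using t[OF that] w0[OF that] by (simp add: W_def) (smt (verit))
      have per: "one_periodic (\<lambda>x. w d x - w\<^sub>0 x)"
        using w_sol[OF \<open>d > 0\<close>] w0_periodic by (auto simp: cell_solution_def one_periodic_def)
      have all: "\<bar>w d x - w\<^sub>0 x - W xbar\<bar> \<le> 2 * \<epsilon> / 5" for x
        using one_periodic_shift[OF per, of xbar x] near by metis
      show ?case
      proof
        fix x
        show "dist (w d x) (w\<^sub>0 x - w\<^sub>0 0) < \<epsilon>"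
          using all[of x] all[of 0] \<open>\<epsilon> > 0\<close>
          unfolding dist_real_def w_norm[OF \<open>d > 0\<close>] by linarith
      qed
    qed
  qed
qed

end
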